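(* Let $n,m\ge1$, let $B_{n,m}$ be the Baumslag-Solitar monoid with generators $a,b$, and let $P_{00}=\{b\}\cup\{b^ia:0\le i\le m-1\}$. Let $T:B_{n,m}\to\mathcal{B}(\mathcal{H})$ be a unital contractive representation on a Hilbert space $\mathcal{H}$. Then $T$ has a $\ast$-regular dilation if and only if $$Z(F)=\sum_{U\subseteq F}(-1)^{|U|}\,TT^*(\vee U)\ \ge\ 0$$ for every finite $F\subset P_{00}$.
   Context: $B_{n,m}$ is the unital semigroup (identity $e$) generated by $a,b$ with the single relation $ab^n=b^ma$. It is known that $P=B_{n,m}$ is right LCM: left cancellative, and for all $p,q\in P$ either $pP\cap qP=\emptyset$ or $pP\cap qP=rP$ for some $r\in P$. For finite $F\subset P$, $\vee F=\{r\in P:\bigcap_{x\in F}xP=rP\}$ (a possibly empty set; $\vee\emptyset$ is the set of invertible elements), $p\vee q=\vee\{p,q\}$. If $s\in pP$, $p^{-1}s$ is the unique $t$ with $pt=s$. A unital contractive representation satisfies $T(e)=I$, $T(pq)=T(p)T(q)$, $\|T(p)\|\le1$. $TT^*(p)=T(p)T(p)^*$; $TT^*(\vee U)=TT^*(r)$ for any $r\in\vee U$, and $0$ if $\vee U$ is the empty set. The term $U=\emptyset$ of $Z(F)$ is $I$. $T$ has a $\ast$-regular dilation (is $\ast$-regular) if the kernel $K(p,q)=T(p^{-1}s)T(q^{-1}s)^*$ for $s\in p\vee q$ (and $K(p,q)=0$ if $p\vee q=\emptyset$) is completely positive definite, i.e. $[K(p_i,p_j)]_{i,j}\ge0$ for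 all $p_1,\dots,p_k\in P$. *)

theory Defs
  imports
    "HOL-Analysis.Analysis"
    "HOL-Algebra.Coset"
    "HOL-Library.Complex_Order"
begin

section \<open>Complex Hilbert spaces and bounded operators\<close>

text \<open>The inner product is linear in the first argument.\<close>

class complex_inner = real_normed_vector +
  fixes scaleC :: "complex \<Rightarrow> 'a \<Rightarrow> 'a"  (infixr \<open>*\<^sub>C\<close> 75)
    and cinner :: "'a \<Rightarrow> 'a \<Rightarrow> complex"
  assumes scaleC_add_right: "c *\<^sub>C (x + y) = c *\<^sub>C x + c *\<^sub>C y"
    and scaleC_add_left: "(c + d) *\<^sub>C x = c *\<^sub>C x + d *\<^sub>C x"
    and scaleC_scaleC: "c *\<^sub>C (d *\<^sub>C x) = (c * d) *\<^sub>C x"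
    and scaleR_scaleC: "r *\<^sub>R x = complex_of_real r *\<^sub>C x"
    and cinner_commute: "cinner x y = cnj (cinner y x)"
    and cinner_add_left: "cinner (x + y) z = cinner x z + cinner y z"
    and cinner_scaleC_left: "cinner (c *\<^sub>C x) y = c * cinner x y"
    and cinner_ge_zero: "0 \<le> cinner x x"
    and cinner_eq_zero_iff: "cinner x x = 0 \<longleftrightarrow> x = 0"
    and norm_eq_sqrt_cinner: "norm x = sqrt (cmod (cinner x x))"

class chilbert_space = complex_inner + complete_space

instantiation complex :: chilbert_space
begin

definition scaleC_complex :: "complex \<Rightarrow> complex \<Rightarrow> complex"
  where "scaleC_complex c x = c * x"

definition cinner_complex :: "complex \<Rightarrow> complex \<Rightarrow> complex"
  where "cinner_complex x y = x * cnj y"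

instance
  by standard
    (auto simp: scaleC_complex_def cinner_complex_def algebra_simps scaleR_conv_of_real
      norm_mult less_eq_complex_def)

end

text \<open>
  Elements of \<open>'h \<Rightarrow>\<^sub>L 'h\<close> are only real linear; the bounded operators on the complex space
  \<open>'h\<close> are those that in addition satisfy the following predicate.
\<close>

definition clinear_op :: "('h::complex_inner \<Rightarrow>\<^sub>L 'h) \<Rightarrow> bool"
  where "clinear_op A \<longleftrightarrow> (\<forall>c x. A (c *\<^sub>C x) = c *\<^sub>C A x)"

text \<open>
  For a complex linear operator on a Hilbert space there is exactly one such \<open>B\<close>, by the
  Riesz representation theorem.
\<close>

definition hadjoint :: "('h::chilbert_space \<Rightarrow>\<^sub>L 'h) \<Rightarrow> 'h \<Rightarrow>\<^sub>L 'h"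
  where "hadjoint A = (THE B :: 'h \<Rightarrow>\<^sub>L 'h. \<forall>x y. cinner (A x) y = cinner x (B y))"

text \<open>The order on \<^typ>\<open>complex\<close> is such that \<open>0 \<le> z\<close> means that \<open>z\<close> is real and nonnegative.\<close>

definition positive_op :: "('h::complex_inner \<Rightarrow>\<^sub>L 'h) \<Rightarrow> bool"
  where "positive_op A \<longleftrightarrow> (\<forall>x. 0 \<le> cinner (A x) x)"


section \<open>The Baumslag-Solitar monoids\<close>

datatype bs_gen = Gen_a | Gen_b

text \<open>The congruence on the free monoid generated by \<open>a b\<^sup>n = b\<^sup>m a\<close>.\<close>

inductive bs_eq :: "nat \<Rightarrow> nat \<Rightarrow> bs_gen list \<Rightarrow> bs_gen list \<Rightarrow> bool" for n m where
  relation: "bs_eq n m (Gen_a # replicate n Gen_b) (replicate m Gen_b @ [Gen_a])"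
| refl: "bs_eq n m u u"
| sym: "bs_eq n m u v \<Longrightarrow> bs_eq n m v u"
| trans: "bs_eq n m u v \<Longrightarrow> bs_eq n m v w \<Longrightarrow> bs_eq n m u w"
| append: "bs_eq n m u u' \<Longrightarrow> bs_eq n m v v' \<Longrightarrow> bs_eq n m (u @ v) (u' @ v')"

definition bs_class :: "nat \<Rightarrow> nat \<Rightarrow> bs_gen list \<Rightarrow> bs_gen list set"
  where "bs_class n m u = {v. bs_eq n m u v}"

definition BS :: "nat \<Rightarrow> nat \<Rightarrow> bs_gen list set monoid"
  where "BS n m =
    \<lparr>carrier = range (bs_class n m),
     mult = (\<lambda>X Y. \<Union>u\<in>X. \<Union>v\<in>Y. bs_class n m (u @ v)),
     one = bs_class n m []\<rparr>"

definition bs_a :: "nat \<Rightarrow> nat \<Rightarrow> bs_gen list set"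
  where "bs_a n m = bs_class n m [Gen_a]"

definition bs_b :: "nat \<Rightarrow> nat \<Rightarrow> bs_gen list set"
  where "bs_b n m = bs_class n m [Gen_b]"

definition P00 :: "nat \<Rightarrow> nat \<Rightarrow> bs_gen list set set"
  where "P00 n m =
    {bs_b n m} \<union> {bs_b n m [^]\<^bsub>BS n m\<^esub> i \<otimes>\<^bsub>BS n m\<^esub> bs_a n m | i::nat. i < m}"

lemma bs_class_eq_iff: "bs_class n m u = bs_class n m v \<longleftrightarrow> bs_eq n m u v"
  unfolding bs_class_def using bs_eq.refl bs_eq.sym bs_eq.trans by blast

lemma BS_mult_class:
  "bs_class n m u \<otimes>\<^bsub>BS n m\<^esub> bs_class n m v = bs_class n m (u @ v)"
proof -
  have "bs_class n m (u' @ v') = bs_class n m (u @ v)"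
    if "u' \<in> bs_class n m u" "v' \<in> bs_class n m v" for u' v'
  proof -
    have "bs_eq n m u u'" "bs_eq n m v v'"
      using that by (simp_all add: bs_class_def)
    then have "bs_eq n m (u @ v) (u' @ v')"
      by (rule bs_eq.append)
    then show ?thesis
      unfolding bs_class_eq_iff by (rule bs_eq.sym)
  qed
  then have "(\<Union>u'\<in>bs_class n m u. \<Union>v'\<in>bs_class n m v. bs_class n m (u' @ v')) =
      (\<Union>u'\<in>bs_class n m u. \<Union>v'\<in>bs_class n m v. bs_class n m (u @ v))"
    by (intro SUP_cong) simp_all
  moreover have "u \<in> bs_class n m u" "v \<in> bs_class n m v"
    by (simp_all add: bs_class_def bs_eq.refl)
  then have "bs_class n m u \<noteq> {}" "bs_class n m v \<noteq> {}"
    by auto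
  ultimately show ?thesis
    by (simp add: BS_def)
qed

lemma monoid_BS: "monoid (BS n m)"
proof -
  have carr: "carrier (BS n m) = range (bs_class n m)"
    and one: "\<one>\<^bsub>BS n m\<^esub> = bs_class n m []"
    by (simp_all add: BS_def)
  show ?thesis
    by (rule monoidI) (auto simp: carr one BS_mult_class)
qed

lemma BS_relation:
  "bs_a n m \<otimes>\<^bsub>BS n m\<^esub> bs_b n m [^]\<^bsub>BS n m\<^esub> n =
   bs_b n m [^]\<^bsub>BS n m\<^esub> m \<otimes>\<^bsub>BS n m\<^esub> bs_a n m"
proof -
  have one: "\<one>\<^bsub>BS n m\<^esub> = bs_class n m []"
    by (simp add: BS_def)
  have pow: "bs_b n m [^]\<^bsub>BS n m\<^esub> k = bs_class n m (replicate k Gen_b)" for k :: nat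
    by (induction k)
      (simp_all add: one bs_b_def BS_mult_class nat_pow_def replicate_append_same)
  show ?thesis
    by (simp add: pow bs_a_def BS_mult_class bs_class_eq_iff bs_eq.relation)
qed


section \<open>Representations of right LCM monoids\<close>

definition vee :: "('g, 'r) monoid_scheme \<Rightarrow> 'g set \<Rightarrow> 'g set"
  where "vee P F =
    (if F = {} then Units P
     else {r \<in> carrier P. (\<Inter>x\<in>F. x <#\<^bsub>P\<^esub> carrier P) = r <#\<^bsub>P\<^esub> carrier P})"

text \<open>\<open>left_quot P p s\<close> is \<open>p\<^sup>-\<^sup>1 s\<close>, for \<open>s \<in> p P\<close> in a left cancellative monoid \<open>P\<close>.\<close>

definition left_quot :: "('g, 'r) monoid_scheme \<Rightarrow> 'g \<Rightarrow> 'g \<Rightarrow> 'g"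
  where "left_quot P p s = (THE t. t \<in> carrier P \<and> p \<otimes>\<^bsub>P\<^esub> t = s)"

definition contractive_rep ::
  "('g, 'r) monoid_scheme \<Rightarrow> ('g \<Rightarrow> 'h::complex_inner \<Rightarrow>\<^sub>L 'h) \<Rightarrow> bool"
  where "contractive_rep P T \<longleftrightarrow>
    T \<one>\<^bsub>P\<^esub> = id_blinfun \<and>
    (\<forall>p\<in>carrier P. \<forall>q\<in>carrier P. T (p \<otimes>\<^bsub>P\<^esub> q) = T p o\<^sub>L T q) \<and>
    (\<forall>p\<in>carrier P. clinear_op (T p) \<and> norm (T p) \<le> 1)"

definition TTstar :: "('g \<Rightarrow> 'h::chilbert_space \<Rightarrow>\<^sub>L 'h) \<Rightarrow> 'g \<Rightarrow> 'h \<Rightarrow>\<^sub>L 'h"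
  where "TTstar T p = T p o\<^sub>L hadjoint (T p)"

text \<open>
  Two elements of \<open>vee P U\<close> differ by right multiplication with an invertible element, and the
  only invertible element of a Baumslag-Solitar monoid is the identity, so the choices of
  \<open>SOME r\<close> and \<open>SOME s\<close> below are immaterial.
\<close>

definition TTstar_vee ::
  "('g, 'r) monoid_scheme \<Rightarrow> ('g \<Rightarrow> 'h::chilbert_space \<Rightarrow>\<^sub>L 'h) \<Rightarrow> 'g set \<Rightarrow> 'h \<Rightarrow>\<^sub>L 'h"
  where "TTstar_vee P T U =
    (if U = {} then id_blinfun
     else if vee P U = {} then 0
     else TTstar T (SOME r. r \<in> vee P U))"

definition Z ::
  "('g, 'r) monoid_scheme \<Rightarrow> ('g \<Rightarrow> 'h::chilbert_space \<Rightarrow>\<^sub>L 'h) \<Rightarrow> 'g set \<Rightarrow> 'h \<Rightarrow>\<^sub>L 'h"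
  where "Z P T F = (\<Sum>U\<in>Pow F. (- 1) ^ card U *\<^sub>R TTstar_vee P T U)"

definition regular_kernel ::
  "('g, 'r) monoid_scheme \<Rightarrow> ('g \<Rightarrow> 'h::chilbert_space \<Rightarrow>\<^sub>L 'h) \<Rightarrow> 'g \<Rightarrow> 'g \<Rightarrow> 'h \<Rightarrow>\<^sub>L 'h"
  where "regular_kernel P T p q =
    (if vee P {p, q} = {} then 0
     else let s = SOME s. s \<in> vee P {p, q}
          in T (left_quot P p s) o\<^sub>L hadjoint (T (left_quot P q s)))"

text \<open>
  Positivity of the operator matrix \<open>[K (p i) (p j)]\<close> on the \<open>k\<close>-fold direct sum of the Hilbert
  space with itself; the \<open>p i\<close> need not be distinct.
\<close>

definition completely_positive_definite ::
  "('g, 'r) monoid_scheme \<Rightarrow> ('g \<Rightarrow> 'g \<Rightarrow> 'h::complex_inner \<Rightarrow>\<^sub>L 'h) \<Rightarrow> bool"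
  where "completely_positive_definite P K \<longleftrightarrow>
    (\<forall>(k::nat) (p :: nat \<Rightarrow> 'g) (h :: nat \<Rightarrow> 'h). (\<forall>i<k. p i \<in> carrier P) \<longrightarrow>
      0 \<le> (\<Sum>i<k. cinner (\<Sum>j<k. K (p i) (p j) (h j)) (h i)))"

definition star_regular ::
  "('g, 'r) monoid_scheme \<Rightarrow> ('g \<Rightarrow> 'h::chilbert_space \<Rightarrow>\<^sub>L 'h) \<Rightarrow> bool"
  where "star_regular P T \<longleftrightarrow> completely_positive_definite P (regular_kernel P T)"

end

(*
  Put S p = T(p)^*, so that the regular kernel has the form <K(p,q)g, h> = <S(v)g, S(u)h> when
  pu = qv generates pP \<inter> qP. Elements of the monoid have normal forms b^k and b^i a x with i < m.
  Let D = I - sum_{u<m} T(b^u a) T(b^u a)^*. The conditions Z(F) \<ge> 0 reduce to D \<ge> 0 and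
  D \<ge> T(b) D T(b)^*, because Z({a,b}) = D - T(b) D T(b)^*.

  For each i < m replace an entry (b^i a x, h) by (x, h), an entry (b^j a x, h) with j \<noteq> i by (e, 0),
  and an entry (b^k, h) by (b^{nc}, S(b^u a)h), where b^k b^u a = b^i a b^{nc} and u < m. The kernel
  is entrywise the sum of the kernels of these m new families plus the Toeplitz kernel
  T(b)^{l-k} D on the powers of b, and the latter is positive by telescoping along
  D - T(b) D T(b)^*. Positivity follows by induction on the number of letters a. Conversely, the
  conditions on D are the positivity of the kernel at (e, b^u a) with vectors (h, -S(b^u a)h), and
  at (e, b, a, a b^n) with vectors (h, -S(b)h, -S(a)h, S(a b^n)h).
*)
theory Submission
  imports Defs
begin

section \<open>Adjoints on Hilbert spaces\<close>

lemma cinner_add_right: "cinner x (y + z) = cinner x y + cinner (x::'a::complex_inner) z"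
  using arg_cong[OF cinner_add_left[of y z x], of cnj]
  by (simp add: cinner_commute[symmetric])

lemma cinner_zero_left [simp]: "cinner 0 (y::'a::complex_inner) = 0"
  using cinner_add_left[of 0 0 y] by simp

lemma cinner_zero_right [simp]: "cinner (x::'a::complex_inner) 0 = 0"
  using cinner_add_right[of x 0 0] by simp

lemma cinner_minus_left [simp]: "cinner (- x) (y::'a::complex_inner) = - cinner x y"
  using cinner_add_left[of x "- x" y] by (simp add: add_eq_0_iff)

lemma cinner_minus_right [simp]: "cinner x (- y::'a::complex_inner) = - cinner x y"
  using cinner_add_right[of x y "- y"] by (simp add: add_eq_0_iff)

lemma cinner_diff_right: "cinner x (y - z::'a::complex_inner) = cinner x y - cinner x z"
  using cinner_add_right[of x y "- z"] by simp

lemma cinner_sum_left: "cinner (\<Sum>i\<in>I. f i) (y::'a::complex_inner) = (\<Sum>i\<in>I. cinner (f i) y)"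
  by (induction I rule: infinite_finite_induct) (simp_all add: cinner_add_left)

lemma cinner_scaleC_right: "cinner x (c *\<^sub>C y) = cnj c * cinner (x::'a::complex_inner) y"
  using arg_cong[OF cinner_scaleC_left[of c y x], of cnj]
  by (simp add: cinner_commute[symmetric])

lemma cinner_scaleR_left: "cinner (r *\<^sub>R x) (y::'a::complex_inner) = of_real r * cinner x y"
  by (simp add: scaleR_scaleC cinner_scaleC_left)

lemma cinner_scaleR_right: "cinner (x::'a::complex_inner) (r *\<^sub>R y) = of_real r * cinner x y"
  by (simp add: scaleR_scaleC cinner_scaleC_right)

lemma cinner_self: "cinner x x = complex_of_real ((norm (x::'a::complex_inner))\<^sup>2)"
proof -
  have "0 \<le> cinner x x"
    by (rule cinner_ge_zero)
  then have "cinner x x = complex_of_real (cmod (cinner x x))"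
    by (simp add: less_eq_complex_def complex_eq_iff cmod_def)
  then show ?thesis
    by (simp add: norm_eq_sqrt_cinner[of x])
qed

lemma norm_add_square:
  "(norm (x + y))\<^sup>2 = (norm x)\<^sup>2 + (norm y)\<^sup>2 + 2 * Re (cinner x (y::'a::complex_inner))"
proof -
  have "complex_of_real ((norm (x + y))\<^sup>2)
      = of_real ((norm x)\<^sup>2) + of_real ((norm y)\<^sup>2) + (cinner x y + cnj (cinner x y))"
    unfolding cinner_self[symmetric] cinner_commute[of x y, symmetric]
    by (simp add: cinner_add_left cinner_add_right cinner_commute[of y x])
  then show ?thesis
    by (simp add: complex_eq_iff)
qed

text \<open>The triangle inequality comes with the norm; squaring it and expanding by
  \<open>norm_add_square\<close> gives Cauchy-Schwarz for real parts.\<close>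

lemma Re_cinner_le: "Re (cinner x y) \<le> norm x * norm (y::'a::complex_inner)"
proof -
  have "(norm (x + y))\<^sup>2 \<le> (norm x + norm y)\<^sup>2"
    by (simp add: norm_triangle_ineq power_mono)
  then show ?thesis
    unfolding norm_add_square by (simp add: power2_eq_square algebra_simps)
qed

lemma abs_Re_cinner_le: "\<bar>Re (cinner x y)\<bar> \<le> norm x * norm (y::'a::complex_inner)"
  using Re_cinner_le[of x y] Re_cinner_le[of "- x" y] by simp

lemma cinner_eqI:
  assumes "\<And>x. cinner x y = cinner x (z::'a::complex_inner)"
  shows "y = z"
proof -
  have "cinner (y - z) (y - z) = 0"
    using assms[of "y - z"] by (simp add: cinner_diff_right)
  then show ?thesis
    by (simp add: cinner_eq_zero_iff)
qed

text \<open>The representing vector minimizes \<open>\<parallel>x\<parallel>\<^sup>2 - 2 f x\<close>.\<close>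

lemma riesz_representation_Re:
  fixes f :: "'h::chilbert_space \<Rightarrow> real"
  assumes "bounded_linear f"
  shows "\<exists>z. \<forall>v. f v = Re (cinner v z)"
proof -
  interpret f: bounded_linear f by fact
  define J where "J x = (norm x)\<^sup>2 - 2 * f x" for x
  obtain K where K: "\<And>x. norm (f x) \<le> norm x * K"
    using f.bounded by blast
  have lower: "- K\<^sup>2 \<le> J x" for x
  proof -
    have "0 \<le> (norm x - K)\<^sup>2" by simp
    also have "\<dots> = (norm x)\<^sup>2 - 2 * (norm x * K) + K\<^sup>2"
      by (simp add: power2_diff)
    also have "\<dots> \<le> J x + K\<^sup>2"
      using K[of x] by (simp add: J_def)
    finally show ?thesis by simp
  qed
  have bdd: "bdd_below (range J)"
    using lower by (auto intro!: bdd_belowI)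
  define I where "I = Inf (range J)"
  have I_le: "I \<le> J x" for x
    unfolding I_def by (rule cInf_lower[OF _ bdd]) simp
  have "\<exists>x. J x < I + 1 / real (Suc k)" for k
    using cInf_lessD[of "range J" "I + 1 / real (Suc k)"] by (auto simp: I_def)
  then obtain X where X: "\<And>k. J (X k) < I + 1 / real (Suc k)"
    by metis
  \<comment> \<open>Parallelogram law; the linear part of \<open>J\<close> cancels at the
    midpoint.\<close>
  have par: "J x + J y - 2 * J ((1/2) *\<^sub>R (x + y)) = (norm (x - y))\<^sup>2 / 2" for x y
  proof -
    have 1: "(norm ((1/2) *\<^sub>R (x + y)))\<^sup>2 = (norm (x + y))\<^sup>2 / 4"
      by (simp add: power_divide)
    show ?thesis
      using norm_add_square[of x y] norm_add_square[of x "- y"]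
      unfolding J_def 1 by (simp add: f.scaleR f.add field_simps)
  qed
  \<comment> \<open>The midpoint still has value at least \<open>I\<close>, so near-minimizers lie
    close together.\<close>
  have close: "(norm (X k - X l))\<^sup>2 \<le> 2 * (1 / real (Suc k) + 1 / real (Suc l))" for k l
    using par[of "X k" "X l"] X[of k] X[of l] I_le[of "(1/2) *\<^sub>R (X k + X l)"] by argo
  have "Cauchy X"
  proof (rule metric_CauchyI)
    fix e :: real assume "e > 0"
    then obtain N where N: "inverse (real (Suc N)) < e\<^sup>2 / 4"
      using reals_Archimedean[of "e\<^sup>2 / 4"] by auto
    have "dist (X k) (X l) < e" if "k \<ge> N" "l \<ge> N" for k l
    proof -
      have "1 / real (Suc k) \<le> 1 / real (Suc N)" "1 / real (Suc l) \<le> 1 / real (Suc N)"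
        using that by (simp_all add: field_simps)
      then have "(norm (X k - X l))\<^sup>2 < e\<^sup>2"
        using close[of k l] N by (simp add: inverse_eq_divide)
      then show ?thesis
        using \<open>e > 0\<close> by (simp add: dist_norm power_less_imp_less_base)
    qed
    then show "\<exists>N. \<forall>k\<ge>N. \<forall>l\<ge>N. dist (X k) (X l) < e"
      by blast
  qed
  then obtain z where z: "X \<longlonglongrightarrow> z"
    using Cauchy_convergent convergent_def by blast
  have "(\<lambda>k. J (X k)) \<longlonglongrightarrow> J z"
    unfolding J_def by (intro tendsto_intros f.tendsto z)
  moreover have "(\<lambda>k. I + 1 / real (Suc k)) \<longlonglongrightarrow> I"
    using tendsto_add[OF tendsto_const LIMSEQ_inverse_real_of_nat, of I] by (simp add: inverse_eq_divide)
  ultimately have "J z \<le> I"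
    using X by (intro LIMSEQ_le) (auto intro: less_imp_le)
  then have min: "J z \<le> J x" for x
    using I_le[of x] by linarith
  have "f v = Re (cinner v z)" for v
  proof -
    define c where "c = Re (cinner v z) - f v"
    define N where "N = (norm v)\<^sup>2"
    \<comment> \<open>Along v the functional changes by t^2 N + 2 t c, with minimizer -c / N; the
      denominator N + 1 also covers v = 0. Minimality of z forces t = 0, hence c = 0.\<close>
    define t where "t = - c / (N + 1)"
    have "N \<ge> 0" by (simp add: N_def)
    have "Re (cinner z v) = Re (cinner v z)"
      by (subst cinner_commute) simp
    then have "J (z + t *\<^sub>R v) = J z + t\<^sup>2 * N + 2 * t * c"
      by (simp add: J_def norm_add_square f.add f.scaleR cinner_scaleR_right power_mult_distrib
          c_def N_def algebra_simps)
    then have "0 \<le> t\<^sup>2 * N + 2 * t * c"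
      using min[of "z + t *\<^sub>R v"] by simp
    also have "c = - t * (N + 1)"
      using \<open>N \<ge> 0\<close> by (simp add: t_def)
    finally have "t\<^sup>2 * (N + 2) \<le> 0"
      by (simp add: algebra_simps power2_eq_square)
    then have "t = 0"
      using \<open>N \<ge> 0\<close> by (simp add: mult_le_0_iff)
    then show ?thesis
      using \<open>N \<ge> 0\<close> by (simp add: t_def c_def)
  qed
  then show ?thesis by blast
qed

text \<open>\<open>hadjoint\<close> is a definite description, so existence and uniqueness of a
  bounded operator are both shown. Existence comes from representing the real part of <A v, y> as a
  functional of v.\<close>

lemma cinner_hadjoint:
  fixes A :: "'h::chilbert_space \<Rightarrow>\<^sub>L 'h"
  assumes A: "clinear_op A"
  shows "cinner (A x) y = cinner x (hadjoint A y)"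
proof -
  have "\<exists>z. \<forall>v. Re (cinner (A v) y) = Re (cinner v z)" for y
  proof (rule riesz_representation_Re, rule bounded_linear_intro)
    show "norm (Re (cinner (A v) y)) \<le> norm v * (norm A * norm y)" for v
      using abs_Re_cinner_le[of "A v" y] mult_right_mono[OF norm_blinfun[of A v], of "norm y"]
      by (simp add: mult_ac)
  qed (simp_all add: blinfun.add_right blinfun.scaleR_right cinner_add_left cinner_scaleR_left)
  then obtain C where C: "\<And>v y. Re (cinner (A v) y) = Re (cinner v (C y))"
    by metis
  \<comment> \<open>Complex linearity of A recovers the imaginary part at v from the real part at
    \<i> v.\<close>
  have C': "cinner (A v) y = cinner v (C y)" for v y
  proof (rule complex_eqI)
    show "Im (cinner (A v) y) = Im (cinner v (C y))"
      using C[of "\<i> *\<^sub>C v" y] A by (simp add: clinear_op_def cinner_scaleC_left)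
  qed (rule C)
  have "bounded_linear C"
  proof (rule bounded_linear_intro)
    show "C (x + y) = C x + C y" for x y
      by (rule cinner_eqI) (simp add: C'[symmetric] cinner_add_right)
    show "C (r *\<^sub>R x) = r *\<^sub>R C x" for r x
      by (rule cinner_eqI) (simp add: C'[symmetric] cinner_scaleR_right)
    show "norm (C y) \<le> norm y * norm A" for y
    proof (cases "C y = 0")
      case False
      have "norm (C y) * norm (C y) = Re (cinner (C y) (C y))"
        by (simp add: cinner_self power2_eq_square)
      also have "\<dots> \<le> norm (A (C y)) * norm y"
        using Re_cinner_le[of "A (C y)" y] by (simp add: C')
      also have "\<dots> \<le> norm (C y) * (norm y * norm A)"
        using mult_right_mono[OF norm_blinfun[of A "C y"], of "norm y"] by (simp add: mult_ac)
      finally show ?thesis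
        using False by simp
    qed simp
  qed
  then obtain B where B: "C = blinfun_apply B"
    using bounded_linear_Blinfun_apply by metis
  have "\<exists>!B :: 'h \<Rightarrow>\<^sub>L 'h. \<forall>x y. cinner (A x) y = cinner x (B y)"
  proof (rule ex1I[of _ B])
    fix B' :: "'h \<Rightarrow>\<^sub>L 'h"
    assume B': "\<forall>x y. cinner (A x) y = cinner x (B' y)"
    show "B' = B"
    proof (rule blinfun_eqI, rule cinner_eqI)
      fix y x
      have "cinner x (B' y) = cinner (A x) y"
        using B' by simp
      also have "\<dots> = cinner x (B y)"
        by (simp only: C' B)
      finally show "cinner x (B' y) = cinner x (B y)" .
    qed
  next
    show "\<forall>x y. cinner (A x) y = cinner x (B y)"
      using C' unfolding B by blast
  qed
  from theI'[OF this] show ?thesis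
    unfolding hadjoint_def by blast
qed

lemma norm_hadjoint_le:
  assumes "clinear_op A"
  shows "norm (hadjoint A y) \<le> norm A * norm y"
proof (cases "hadjoint A y = 0")
  case False
  let ?z = "hadjoint A y"
  have "norm ?z * norm ?z = Re (cinner (A ?z) y)"
    by (simp add: cinner_hadjoint[OF assms] cinner_self power2_eq_square)
  also have "\<dots> \<le> norm (A ?z) * norm y"
    by (rule Re_cinner_le)
  also have "\<dots> \<le> norm ?z * (norm A * norm y)"
    using mult_right_mono[OF norm_blinfun[of A ?z], of "norm y"] by (simp add: mult_ac)
  finally show ?thesis
    using False by simp
qed simp

section \<open>Toeplitz kernels\<close>

text \<open>The exponent k belongs to h and l to g, matching the argument order of
  \<open>kform\<close>. For the inner product and \<beta> = T(b)^* this is the regular kernel on the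
  powers of b.\<close>

definition toeplitz_form ::
  "('h \<Rightarrow> 'h \<Rightarrow> complex) \<Rightarrow> ('h \<Rightarrow> 'h) \<Rightarrow> nat \<Rightarrow> nat \<Rightarrow> 'h \<Rightarrow> 'h \<Rightarrow> complex"
  where "toeplitz_form \<rho> \<beta> k l g h =
    (if k \<le> l then \<rho> g ((\<beta> ^^ (l - k)) h) else \<rho> ((\<beta> ^^ (k - l)) g) h)"

text \<open>Covers both the inner product and the possibly degenerate defect form, each with \<beta>
  = T(b)^*.\<close>

locale contracted_form =
  fixes \<rho> :: "'h::ab_group_add \<Rightarrow> 'h \<Rightarrow> complex" and \<beta> :: "'h \<Rightarrow> 'h"
  assumes form_add_left: "\<rho> (x + y) z = \<rho> x z + \<rho> y z"
    and form_add_right: "\<rho> x (y + z) = \<rho> x y + \<rho> x z"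
    and map_add: "\<beta> (x + y) = \<beta> x + \<beta> y"
    and form_nonneg: "0 \<le> \<rho> x x"
    and form_contract: "\<rho> (\<beta> x) (\<beta> x) \<le> \<rho> x x"
begin

lemma form_zero_left [simp]: "\<rho> 0 x = 0"
  using form_add_left[of 0 0 x] by simp

lemma form_zero_right [simp]: "\<rho> x 0 = 0"
  using form_add_right[of x 0 0] by simp

lemma map_zero [simp]: "\<beta> 0 = 0"
  using map_add[of 0 0] by simp

lemma map_sum: "\<beta> (\<Sum>j\<in>J. y j) = (\<Sum>j\<in>J. \<beta> (y j))"
  by (induction J rule: infinite_finite_induct) (simp_all add: map_add)

lemma sum_form: "(\<Sum>j\<in>J. \<Sum>l\<in>J. \<rho> (y l) (y j)) = \<rho> (\<Sum>j\<in>J. y j) (\<Sum>j\<in>J. y j)"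
proof -
  have "\<rho> (\<Sum>l\<in>L. y l) z = (\<Sum>l\<in>L. \<rho> (y l) z)" for z L
    by (induction L rule: infinite_finite_induct) (simp_all add: form_add_left)
  moreover have "\<rho> z (\<Sum>l\<in>L. y l) = (\<Sum>l\<in>L. \<rho> z (y l))" for z L
    by (induction L rule: infinite_finite_induct) (simp_all add: form_add_right)
  ultimately show ?thesis
    by simp
qed

text \<open>For t below max k l one of the two vectors \<open>Y\<close> is 0. From there on \<beta>
  carries \<open>Y\<close> at t to \<open>Y\<close> at t + 1, so the differences telescope against
  the last term and leave the value at max k l, which is the Toeplitz entry.\<close>

lemma toeplitz_telescope:
  fixes k l N :: nat and g h :: 'h
  assumes "k \<le> N" "l \<le> N"
  defines "Y \<equiv> \<lambda>k h t. if k \<le> t then (\<beta> ^^ (t - k)) h else 0"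
  shows "toeplitz_form \<rho> \<beta> k l g h =
    (\<Sum>t<N. \<rho> (Y l g t) (Y k h t) - \<rho> (\<beta> (Y l g t)) (\<beta> (Y k h t))) + \<rho> (Y l g N) (Y k h N)"
proof -
  have "max k l \<le> N"
    using assms by simp
  then show ?thesis
  proof (induction N rule: dec_induct)
    case base
    have "\<rho> (Y l g t) (Y k h t) - \<rho> (\<beta> (Y l g t)) (\<beta> (Y k h t)) = 0" if "t < max k l" for t
      using that by (auto simp: Y_def max_def split: if_splits)
    then show ?case
      by (simp add: toeplitz_form_def Y_def)
  next
    case (step N)
    have "\<beta> (Y l g N) = Y l g (Suc N)" "\<beta> (Y k h N) = Y k h (Suc N)"
      using step.hyps by (simp_all add: Y_def Suc_diff_le)
    then show ?case
      using step.IH by simp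
  qed
qed

text \<open>Summed over all entries, biadditivity turns each Gram sum of the telescoped formula into
  one value of \<rho>, where contraction and nonnegativity apply. The bound \<open>N\<close> is
  common to all indices.\<close>

lemma toeplitz_nonneg:
  fixes k :: "'i \<Rightarrow> nat"
  assumes "finite J"
  shows "0 \<le> (\<Sum>j\<in>J. \<Sum>l\<in>J. toeplitz_form \<rho> \<beta> (k j) (k l) (h l) (h j))"
proof -
  define N where "N = Max (k ` J)"
  have N: "k j \<le> N" if "j \<in> J" for j
    unfolding N_def using assms that by simp
  define Y where "Y t j = (if k j \<le> t then (\<beta> ^^ (t - k j)) (h j) else 0)" for t j
  define s where "s t = (\<Sum>j\<in>J. Y t j)" for t
  have "(\<Sum>j\<in>J. \<Sum>l\<in>J. toeplitz_form \<rho> \<beta> (k j) (k l) (h l) (h j)) =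
      (\<Sum>j\<in>J. \<Sum>l\<in>J. (\<Sum>t<N. \<rho> (Y t l) (Y t j) - \<rho> (\<beta> (Y t l)) (\<beta> (Y t j))) + \<rho> (Y N l) (Y N j))"
    unfolding Y_def
    by (rule sum.cong[OF HOL.refl], rule sum.cong[OF HOL.refl], rule toeplitz_telescope) (simp_all add: N)
  also have "\<dots> = (\<Sum>t<N. (\<Sum>j\<in>J. \<Sum>l\<in>J. \<rho> (Y t l) (Y t j))
        - (\<Sum>j\<in>J. \<Sum>l\<in>J. \<rho> (\<beta> (Y t l)) (\<beta> (Y t j)))) + (\<Sum>j\<in>J. \<Sum>l\<in>J. \<rho> (Y N l) (Y N j))"
    by (simp add: sum.distrib sum_subtractf sum.swap[of _ "{..<N}"])
  also have "\<dots> = (\<Sum>t<N. \<rho> (s t) (s t) - \<rho> (\<beta> (s t)) (\<beta> (s t))) + \<rho> (s N) (s N)"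
    by (simp add: sum_form s_def map_sum)
  also have "0 \<le> \<dots>"
    using form_contract form_nonneg by (intro add_nonneg_nonneg sum_nonneg) simp_all
  finally show ?thesis .
qed

end

section \<open>Normal forms in Baumslag-Solitar monoids\<close>

text \<open>\<open>BPow k\<close> and \<open>Syll i x\<close> stand for \<open>b\<^sup>k\<close> and \<open>b\<^sup>i a x\<close>; left multiplication by \<open>b\<^sup>k\<close> is
  computed with \<open>b\<^sup>m a = a b\<^sup>n\<close>.\<close>

datatype bs_nf = BPow nat | Syll nat bs_nf

primrec nf_shift :: "nat \<Rightarrow> nat \<Rightarrow> bs_nf \<Rightarrow> nat \<Rightarrow> bs_nf" where
  "nf_shift n m (BPow j) = (\<lambda>k. BPow (k + j))"
| "nf_shift n m (Syll i x) = (\<lambda>k. Syll ((k + i) mod m) (nf_shift n m x (n * ((k + i) div m))))"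

primrec nf_valid :: "nat \<Rightarrow> bs_nf \<Rightarrow> bool" where
  "nf_valid m (BPow k) \<longleftrightarrow> True"
| "nf_valid m (Syll i x) \<longleftrightarrow> i < m \<and> nf_valid m x"

primrec nf_word :: "bs_nf \<Rightarrow> bs_gen list" where
  "nf_word (BPow k) = replicate k Gen_b"
| "nf_word (Syll i x) = replicate i Gen_b @ Gen_a # nf_word x"

primrec nf_gen :: "nat \<Rightarrow> nat \<Rightarrow> bs_gen \<Rightarrow> bs_nf \<Rightarrow> bs_nf" where
  "nf_gen n m Gen_a x = Syll 0 x"
| "nf_gen n m Gen_b x = nf_shift n m x 1"

text \<open>\<open>m - k mod m\<close> stands for -k modulo m within the natural numbers.\<close>

lemma add_compl_mod: "(i + (m - k mod m) + k) mod m = i mod m" if "0 < m" for i k m :: nat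
proof -
  have "k mod m < m"
    using that by simp
  then have "i + (m - k mod m) + k mod m = i + m"
    by linarith
  then show ?thesis
    by (metis mod_add_right_eq mod_add_self2)
qed

lemma add_mod_cancel:
  fixes i j k m :: nat
  assumes "(k + i) mod m = (k + j) mod m" "i < m" "j < m"
  shows "i = j"
proof -
  have "(i + (m - k mod m) + k) mod m = ((m - k mod m) + (k + i) mod m) mod m"
    by (simp add: mod_simps ac_simps)
  also have "\<dots> = (j + (m - k mod m) + k) mod m"
    unfolding assms(1) by (simp add: mod_simps ac_simps)
  finally show ?thesis
    using assms(2,3) by (subst (asm) (1 2) add_compl_mod) simp_all
qed

text \<open>Both sides of the defining relation contain a letter a, so neither is empty. This is why
  the identity is the only invertible element.\<close>

lemma bs_eq_Nil_iff:
  assumes "bs_eq n m u v"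
  shows "u = [] \<longleftrightarrow> v = []"
  using assms by induction auto

locale bs_monoid =
  fixes n m :: nat
  assumes m_pos: "0 < m"
begin

abbreviation P :: "bs_gen list set monoid"
  where "P \<equiv> BS n m"

abbreviation shift :: "bs_nf \<Rightarrow> nat \<Rightarrow> bs_nf"
  where "shift \<equiv> nf_shift n m"

abbreviation valid :: "bs_nf \<Rightarrow> bool"
  where "valid \<equiv> nf_valid m"

definition act :: "bs_gen list \<Rightarrow> bs_nf \<Rightarrow> bs_nf"
  where "act w x = foldr (nf_gen n m) w x"

definition val :: "bs_nf \<Rightarrow> bs_gen list set"
  where "val x = bs_class n m (nf_word x)"

definition bp :: "nat \<Rightarrow> bs_gen list set"
  where "bp k = bs_class n m (replicate k Gen_b)"

definition bpa :: "nat \<Rightarrow> bs_gen list set"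
  where "bpa i = bs_class n m (replicate i Gen_b @ [Gen_a])"

sublocale monoid P
  by (rule monoid_BS)

lemma carrier_P: "carrier P = range (bs_class n m)"
  by (simp add: BS_def)

lemma one_P: "\<one>\<^bsub>P\<^esub> = bs_class n m []"
  by (simp add: BS_def)

lemma bp_closed [simp, intro]: "bp k \<in> carrier P"
  by (simp add: bp_def carrier_P)

lemma bpa_closed [simp, intro]: "bpa k \<in> carrier P"
  by (simp add: bpa_def carrier_P)

lemma val_closed [simp, intro]: "val x \<in> carrier P"
  by (simp add: val_def carrier_P)

lemma bp_0 [simp]: "bp 0 = \<one>\<^bsub>P\<^esub>"
  by (simp add: bp_def one_P)

lemma bp_add: "bp k \<otimes>\<^bsub>P\<^esub> bp l = bp (k + l)"
  by (simp add: bp_def BS_mult_class replicate_add)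

lemma bp_bpa: "bp k \<otimes>\<^bsub>P\<^esub> bpa i = bpa (k + i)"
  by (simp add: bp_def bpa_def BS_mult_class replicate_add)

lemma val_BPow [simp]: "val (BPow k) = bp k"
  by (simp add: val_def bp_def)

lemma val_Syll: "val (Syll i x) = bpa i \<otimes>\<^bsub>P\<^esub> val x"
  by (simp add: val_def bpa_def BS_mult_class)

lemma bpa_0_bp_n: "bpa 0 \<otimes>\<^bsub>P\<^esub> bp n = bpa m"
  by (simp add: bpa_def bp_def BS_mult_class bs_class_eq_iff bs_eq.relation)

lemma bpa_bp: "bpa i \<otimes>\<^bsub>P\<^esub> bp (n * c) = bpa (i + m * c)"
proof (induction c)
  case 0
  show ?case
    by simp
next
  case (Suc c)
  have "bpa i \<otimes>\<^bsub>P\<^esub> bp (n * Suc c) = (bpa i \<otimes>\<^bsub>P\<^esub> bp (n * c)) \<otimes>\<^bsub>P\<^esub> bp n"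
    by (simp add: m_assoc bp_add add.commute)
  also have "\<dots> = bpa (i + m * c) \<otimes>\<^bsub>P\<^esub> bp n"
    by (simp add: Suc.IH)
  also have "\<dots> = bp (i + m * c) \<otimes>\<^bsub>P\<^esub> (bpa 0 \<otimes>\<^bsub>P\<^esub> bp n)"
    by (simp add: bp_bpa flip: m_assoc)
  also have "\<dots> = bpa (i + m * Suc c)"
    by (simp add: bpa_0_bp_n bp_bpa algebra_simps)
  finally show ?case .
qed

lemma bpa_mod_div: "bpa i = bpa (i mod m) \<otimes>\<^bsub>P\<^esub> bp (n * (i div m))"
  by (simp add: bpa_bp)

lemma bp_val: "bp k \<otimes>\<^bsub>P\<^esub> val x = val (shift x k)"
proof (induction x arbitrary: k)
  case (BPow j)
  show ?case
    by (simp add: bp_add)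
next
  case (Syll i x)
  have "bp k \<otimes>\<^bsub>P\<^esub> val (Syll i x) = bpa (k + i) \<otimes>\<^bsub>P\<^esub> val x"
    by (simp add: val_Syll bp_bpa flip: m_assoc)
  also have "\<dots> = bpa ((k + i) mod m) \<otimes>\<^bsub>P\<^esub> (bp (n * ((k + i) div m)) \<otimes>\<^bsub>P\<^esub> val x)"
    by (subst bpa_mod_div) (simp add: m_assoc)
  finally show ?case
    by (simp add: Syll.IH val_Syll)
qed

lemma shift_valid [simp]: "valid x \<Longrightarrow> valid (shift x k)"
  using m_pos by (induction x arbitrary: k) simp_all

lemma shift_0 [simp]: "valid x \<Longrightarrow> shift x 0 = x"
  by (induction x) simp_all

lemma shift_shift: "shift (shift x k) l = shift x (k + l)"
proof (induction x arbitrary: k l)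
  case (Syll i x)
  \<comment> \<open>Carries add up: first that of k into the digit i, then that of l into the
    remaining digit.\<close>
  have "(k + l + i) div m = (l + (k + i) mod m + m * ((k + i) div m)) div m"
    by (simp add: add.assoc) (simp add: ac_simps)
  also have "\<dots> = (k + i) div m + (l + (k + i) mod m) div m"
    using m_pos by (intro div_mult_self2) simp
  finally show ?case
    by (simp add: Syll.IH mod_simps ac_simps distrib_left)
qed (simp add: ac_simps)

text \<open>The leading digits agree modulo m, hence are equal. Then the carries agree and the tails
  are compared under a new common shift, so y and k vary in the induction.\<close>

lemma shift_inj:
  assumes "valid x" "valid y" "shift x k = shift y k"
  shows "x = y"
  using assms
proof (induction x arbitrary: y k)
  case (BPow j)
  then show ?case
    by (cases y) simp_all
next
  case (Syll i x)
  then obtain j z where y: "y = Syll j z"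
    by (cases y) simp_all
  have "i = j"
    using Syll.prems by (intro add_mod_cancel[of k i m j]) (simp_all add: y)
  then show ?case
    using Syll by (simp add: y)
qed

section \<open>Action of words on normal forms, uniqueness and cancellation\<close>

lemma act_append: "act (u @ v) x = act u (act v x)"
  by (simp add: act_def)

lemma act_valid [simp]: "valid x \<Longrightarrow> valid (act w x)"
proof (induction w)
  case (Cons g w)
  then show ?case
    using m_pos by (cases g) (simp_all add: act_def)
qed (simp add: act_def)

lemma act_replicate: "valid x \<Longrightarrow> act (replicate k Gen_b) x = shift x k"
  by (induction k) (simp_all add: act_def shift_shift)

text \<open>The action respects the relation because shifting \<open>Syll 0 x\<close> by m restores
  the digit 0 and passes a shift by n to x.\<close>

lemma act_cong:
  assumes "bs_eq n m u v" "valid x"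
  shows "act u x = act v x"
  using assms
proof (induction arbitrary: x)
  case relation
  have "act (Gen_a # replicate n Gen_b) x = Syll 0 (shift x n)"
    using relation act_replicate[of x n] by (simp add: act_def)
  moreover have "act (replicate m Gen_b @ [Gen_a]) x = shift (Syll 0 x) m"
    using relation m_pos by (simp add: act_append act_replicate act_def[of "[Gen_a]"])
  ultimately show ?case
    using m_pos by simp
qed (simp_all add: act_append)

lemma act_nf_word: "valid x \<Longrightarrow> act (nf_word x) (BPow 0) = x"
proof (induction x)
  case (Syll i x)
  then have "act (nf_word (Syll i x)) (BPow 0) = act (replicate i Gen_b) (Syll 0 x)"
    by (simp add: act_append) (simp add: act_def)
  then show ?case
    using Syll.prems by (simp add: act_replicate)
qed (simp add: act_replicate)

text \<open>Van der Waerden's argument: the word of x, acting on the normal form of the identity,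
  returns x, and the action depends only on the class of the word.\<close>

lemma val_inj: "inj_on val {x. valid x}"
proof (rule inj_onI)
  fix x y assume *: "x \<in> {x. valid x}" "y \<in> {x. valid x}" "val x = val y"
  then have "act (nf_word x) (BPow 0) = act (nf_word y) (BPow 0)"
    by (intro act_cong) (simp_all add: val_def bs_class_eq_iff)
  then show "x = y"
    using * by (simp add: act_nf_word)
qed

lemma val_eq_iff: "valid x \<Longrightarrow> valid y \<Longrightarrow> val x = val y \<longleftrightarrow> x = y"
  using val_inj by (auto simp: inj_on_def)

lemma class_val: "bs_class n m w \<otimes>\<^bsub>P\<^esub> val x = val (act w x)"
proof (induction w)
  case Nil
  show ?case
    by (simp add: act_def flip: one_P)
next
  case (Cons g w)
  have "bs_class n m (g # w) \<otimes>\<^bsub>P\<^esub> val x = bs_class n m [g] \<otimes>\<^bsub>P\<^esub> val (act w x)"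
    using m_assoc[of "bs_class n m [g]" "bs_class n m w" "val x"]
    by (simp add: carrier_P[THEN equalityD2, THEN subsetD] BS_mult_class flip: Cons.IH)
  also have "\<dots> = val (act (g # w) x)"
    using bp_val[of 1 "act w x"]
    by (cases g) (simp_all add: act_def val_Syll bpa_def bp_def)
  finally show ?case .
qed

lemma carrier_val: "carrier P = val ` {x. valid x}"
proof -
  have "bs_class n m w = val (act w (BPow 0))" for w
    using class_val[of w "BPow 0"] by (simp add: carrier_P)
  then show ?thesis
    by (force simp: carrier_P val_def)
qed

lemma carrierE:
  assumes "p \<in> carrier P"
  obtains x where "valid x" "p = val x"
  using assms by (auto simp: carrier_val)

text \<open>Each generator acts injectively, a by prefixing and b by \<open>shift_inj\<close>; left
  cancellation in the monoid follows.\<close>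

lemma act_inj:
  assumes "valid x" "valid y" "act w x = act w y"
  shows "x = y"
  using assms(3)
proof (induction w)
  case (Cons g w)
  have "act w x = act w y"
    using Cons.prems assms
    by (cases g) (auto simp: act_def[of "_ # _"] simp flip: act_def dest: shift_inj[rotated -1])
  then show ?case
    by (rule Cons.IH)
qed (simp add: act_def)

lemma left_cancel_P:
  assumes "p \<in> carrier P" "q \<in> carrier P" "r \<in> carrier P" "p \<otimes>\<^bsub>P\<^esub> q = p \<otimes>\<^bsub>P\<^esub> r"
  shows "q = r"
proof -
  obtain w where "p = bs_class n m w"
    using assms by (auto simp: carrier_P)
  moreover obtain x y where "valid x" "q = val x" "valid y" "r = val y"
    using assms by (metis carrierE)
  ultimately show ?thesis
    using assms(4) act_inj by (simp add: class_val val_eq_iff)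
qed

lemma conical_P:
  assumes "p \<in> carrier P" "q \<in> carrier P" "p \<otimes>\<^bsub>P\<^esub> q = \<one>\<^bsub>P\<^esub>"
  shows "p = \<one>\<^bsub>P\<^esub>"
proof -
  obtain u v where uv: "p = bs_class n m u" "q = bs_class n m v"
    using assms by (auto simp: carrier_P)
  then have "bs_eq n m (u @ v) []"
    using assms by (simp add: BS_mult_class one_P bs_class_eq_iff)
  then have "u = []"
    using bs_eq_Nil_iff by auto
  then show ?thesis
    by (simp add: uv one_P)
qed

end

section \<open>Regular kernels over cancellative monoids\<close>

text \<open>Trivial invertibles make the generator of a principal right ideal unique, so the choices
  by \<open>SOME\<close> in the kernel and in \<open>TTstar_vee\<close> have a determined
  outcome.\<close>

locale conical_rep = monoid G for G :: "('g, 'r) monoid_scheme" (structure) +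
  fixes T :: "'g \<Rightarrow> 'h::chilbert_space \<Rightarrow>\<^sub>L 'h"
  assumes left_cancel:
      "\<lbrakk>x \<in> carrier G; y \<in> carrier G; z \<in> carrier G; x \<otimes> y = x \<otimes> z\<rbrakk> \<Longrightarrow> y = z"
    and conical: "\<lbrakk>x \<in> carrier G; y \<in> carrier G; x \<otimes> y = \<one>\<rbrakk> \<Longrightarrow> x = \<one>"
    and rep: "contractive_rep G T"
begin

definition is_lcm :: "'g \<Rightarrow> 'g \<Rightarrow> 'g \<Rightarrow> bool"
  where "is_lcm p q r \<longleftrightarrow>
    r \<in> carrier G \<and> (p <#\<^bsub>G\<^esub> carrier G) \<inter> (q <#\<^bsub>G\<^esub> carrier G) = r <#\<^bsub>G\<^esub> carrier G"

definition S :: "'g \<Rightarrow> 'h \<Rightarrow> 'h"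
  where "S p = hadjoint (T p)"

definition kform :: "'g \<Rightarrow> 'g \<Rightarrow> 'h \<Rightarrow> 'h \<Rightarrow> complex"
  where "kform p q g h = cinner (regular_kernel G T p q g) h"

lemma mem_ideal_iff: "x \<in> p <#\<^bsub>G\<^esub> carrier G \<longleftrightarrow> (\<exists>t\<in>carrier G. x = p \<otimes> t)"
  by (auto simp: l_coset_def)

lemma mult_mem_ideal [simp]: "t \<in> carrier G \<Longrightarrow> p \<otimes> t \<in> p <#\<^bsub>G\<^esub> carrier G"
  by (auto simp: l_coset_def)

lemma self_mem_ideal: "p \<in> carrier G \<Longrightarrow> p \<in> p <#\<^bsub>G\<^esub> carrier G"
  using mult_mem_ideal[of \<one> p] by simp

lemma ideal_subset: "p \<in> carrier G \<Longrightarrow> p <#\<^bsub>G\<^esub> carrier G \<subseteq> carrier G"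
  by (auto simp: l_coset_def)

lemma ideal_mult_subset:
  "p \<in> carrier G \<Longrightarrow> u \<in> carrier G \<Longrightarrow> (p \<otimes> u) <#\<^bsub>G\<^esub> carrier G \<subseteq> p <#\<^bsub>G\<^esub> carrier G"
  by (auto simp: mem_ideal_iff) (metis m_assoc m_closed)

lemma ideal_eq_iff:
  assumes "r \<in> carrier G" "s \<in> carrier G"
  shows "r <#\<^bsub>G\<^esub> carrier G = s <#\<^bsub>G\<^esub> carrier G \<longleftrightarrow> r = s"
proof
  assume eq: "r <#\<^bsub>G\<^esub> carrier G = s <#\<^bsub>G\<^esub> carrier G"
  obtain u where u: "u \<in> carrier G" "r = s \<otimes> u"
    using self_mem_ideal[OF assms(1)] unfolding eq mem_ideal_iff by blast
  obtain v where v: "v \<in> carrier G" "s = r \<otimes> v"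
    using self_mem_ideal[OF assms(2)] unfolding eq[symmetric] mem_ideal_iff by blast
  have "s \<otimes> (u \<otimes> v) = s \<otimes> \<one>"
    using u v assms by (simp flip: m_assoc)
  then have "u \<otimes> v = \<one>"
    using left_cancel u v assms by blast
  then have "u = \<one>"
    using conical u v by blast
  then show "r = s"
    using u assms by simp
qed simp

lemma vee_pair: "vee G {p, q} = {r. is_lcm p q r}"
  by (auto simp: vee_def is_lcm_def)

lemma is_lcm_unique: "is_lcm p q r \<Longrightarrow> is_lcm p q s \<Longrightarrow> r = s"
  by (auto simp: is_lcm_def ideal_eq_iff)

lemma vee_pair_lcm: "is_lcm p q r \<Longrightarrow> vee G {p, q} = {r}"
  by (auto simp: vee_pair intro: is_lcm_unique)

lemma vee_singleton:
  assumes "p \<in> carrier G"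
  shows "vee G {p} = {p}"
  using assms by (auto simp: vee_def ideal_eq_iff)

lemma left_quot_mult:
  assumes "p \<in> carrier G" "t \<in> carrier G"
  shows "left_quot G p (p \<otimes> t) = t"
  unfolding left_quot_def using assms by (intro the_equality) (auto intro: left_cancel)

lemma is_lcm_commute: "is_lcm p q r \<longleftrightarrow> is_lcm q p r"
  by (simp add: is_lcm_def Int_commute)

lemma is_lcm_mult:
  assumes "p \<in> carrier G" "t \<in> carrier G"
  shows "is_lcm p (p \<otimes> t) (p \<otimes> t)"
  using assms ideal_mult_subset by (auto simp: is_lcm_def)

lemma is_lcm_factor:
  assumes "p \<in> carrier G" "q \<in> carrier G" "is_lcm p q r"
  obtains u v where "u \<in> carrier G" "v \<in> carrier G" "r = p \<otimes> u" "p \<otimes> u = q \<otimes> v"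
proof -
  have "r \<in> (p <#\<^bsub>G\<^esub> carrier G) \<inter> (q <#\<^bsub>G\<^esub> carrier G)"
    using assms self_mem_ideal[of r] by (simp add: is_lcm_def)
  then show thesis
    using that by (auto simp: mem_ideal_iff)
qed

lemma clinear_T: "p \<in> carrier G \<Longrightarrow> clinear_op (T p)"
  using rep by (simp add: contractive_rep_def)

lemma cinner_T: "p \<in> carrier G \<Longrightarrow> cinner (T p x) y = cinner x (S p y)"
  unfolding S_def by (rule cinner_hadjoint[OF clinear_T])

lemma S_add: "S p (x + y) = S p x + S p y"
  by (simp add: S_def blinfun.add_right)

lemma S_zero [simp]: "S p 0 = 0"
  by (simp add: S_def blinfun.zero_right)

lemma S_minus [simp]: "S p (- x) = - S p x"
  by (simp add: S_def blinfun.minus_right)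

lemma S_one [simp]: "S \<one> x = x"
proof (rule cinner_eqI)
  show "cinner y (S \<one> x) = cinner y x" for y
    using rep cinner_T[of \<one> y x] by (simp add: contractive_rep_def)
qed

lemma S_mult: "p \<in> carrier G \<Longrightarrow> q \<in> carrier G \<Longrightarrow> S (p \<otimes> q) x = S q (S p x)"
proof (rule cinner_eqI)
  fix y assume "p \<in> carrier G" "q \<in> carrier G"
  then show "cinner y (S (p \<otimes> q) x) = cinner y (S q (S p x))"
    using rep by (simp add: contractive_rep_def flip: cinner_T)
qed

lemma cinner_S_le:
  assumes "p \<in> carrier G"
  shows "cinner (S p x) (S p x) \<le> cinner x x"
proof -
  have "norm (S p x) \<le> norm (T p) * norm x"
    unfolding S_def by (rule norm_hadjoint_le[OF clinear_T[OF assms]])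
  also have "\<dots> \<le> norm x"
    using rep assms by (simp add: contractive_rep_def mult_left_le_one_le)
  finally show ?thesis
    by (simp add: cinner_self less_eq_complex_def power_mono)
qed

lemma cinner_TTstar: "p \<in> carrier G \<Longrightarrow> cinner (TTstar T p x) x = cinner (S p x) (S p x)"
  by (simp add: TTstar_def cinner_T flip: S_def)

lemma kform_zero [simp]: "kform p q 0 h = 0" "kform p q g 0 = 0"
  by (simp_all add: kform_def blinfun.zero_right)

lemma kform_no_lcm: "(\<And>r. \<not> is_lcm p q r) \<Longrightarrow> kform p q g h = 0"
  by (simp add: kform_def regular_kernel_def vee_pair)

text \<open>Working form of the kernel: explicit cofactors u of p and v of q replace
  \<open>SOME\<close> and \<open>left_quot\<close>, and T(u) is moved across the inner
  product.\<close>

lemma kform_lcm: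
  assumes "p \<in> carrier G" "q \<in> carrier G" "u \<in> carrier G" "v \<in> carrier G"
    and "is_lcm p q (p \<otimes> u)" and eq: "p \<otimes> u = q \<otimes> v"
  shows "kform p q g h = cinner (S v g) (S u h)"
proof -
  have "vee G {p, q} = {p \<otimes> u}"
    using assms by (intro vee_pair_lcm)
  moreover have "left_quot G q (p \<otimes> u) = v"
    unfolding eq using assms(2,4) by (rule left_quot_mult)
  moreover have "left_quot G p (p \<otimes> u) = u"
    using assms(1,3) by (rule left_quot_mult)
  ultimately have "regular_kernel G T p q = T u o\<^sub>L hadjoint (T v)"
    by (simp add: regular_kernel_def Let_def)
  then show ?thesis
    using assms(3) by (simp add: kform_def cinner_T flip: S_def)
qed

lemma kform_commute:
  assumes "p \<in> carrier G" "q \<in> carrier G"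
  shows "kform q p h g = cnj (kform p q g h)"
proof (cases "\<exists>r. is_lcm p q r")
  case True
  then obtain u v where uv: "u \<in> carrier G" "v \<in> carrier G" "is_lcm p q (p \<otimes> u)" "p \<otimes> u = q \<otimes> v"
    using assms is_lcm_factor by metis
  then have "is_lcm q p (q \<otimes> v)"
    by (simp add: is_lcm_commute)
  then show ?thesis
    using uv assms kform_lcm[of p q u v] kform_lcm[of q p v u] cinner_commute by metis
next
  case False
  then show ?thesis
    using kform_no_lcm is_lcm_commute by (metis complex_cnj_zero)
qed

lemma kform_dvd:
  assumes "p \<in> carrier G" "t \<in> carrier G"
  shows "kform p (p \<otimes> t) g h = cinner g (S t h)"
  using kform_lcm[of p "p \<otimes> t" t \<one>] assms is_lcm_mult by simp

lemma kform_self: "p \<in> carrier G \<Longrightarrow> kform p p g h = cinner g h"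
  using kform_dvd[of p \<one>] by simp

lemma kform_one_left: "q \<in> carrier G \<Longrightarrow> kform \<one> q g h = cinner g (S q h)"
  using kform_dvd[of \<one> q] by simp

text \<open>Since xqP lies in xP, intersecting it with pP amounts to intersecting it with xrP. Left
  multiplication by x is injective and so commutes with intersection.\<close>

lemma Int_ideal_mult:
  assumes carr: "p \<in> carrier G" "x \<in> carrier G" "r \<in> carrier G" "q \<in> carrier G"
    and lcm: "is_lcm p x (x \<otimes> r)"
  shows "(p <#\<^bsub>G\<^esub> carrier G) \<inter> ((x \<otimes> q) <#\<^bsub>G\<^esub> carrier G) =
    (\<otimes>) x ` ((r <#\<^bsub>G\<^esub> carrier G) \<inter> (q <#\<^bsub>G\<^esub> carrier G))"
proof -
  have ideal: "(x \<otimes> y) <#\<^bsub>G\<^esub> carrier G = (\<otimes>) x ` (y <#\<^bsub>G\<^esub> carrier G)" if "y \<in> carrier G" for y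
    using that carr by (auto simp: l_coset_def m_assoc)
  have inj: "inj_on ((\<otimes>) x) (carrier G)"
    using carr left_cancel by (auto intro: inj_onI)
  have "(p <#\<^bsub>G\<^esub> carrier G) \<inter> ((x \<otimes> q) <#\<^bsub>G\<^esub> carrier G) =
      ((x \<otimes> r) <#\<^bsub>G\<^esub> carrier G) \<inter> ((x \<otimes> q) <#\<^bsub>G\<^esub> carrier G)"
    using lcm ideal_mult_subset[of x q] carr by (auto simp: is_lcm_def)
  also have "\<dots> = (\<otimes>) x ` ((r <#\<^bsub>G\<^esub> carrier G) \<inter> (q <#\<^bsub>G\<^esub> carrier G))"
    using carr ideal_subset by (simp add: ideal inj_on_image_Int[OF inj])
  finally show ?thesis .
qed

text \<open>An lcm of p and xq is x times an lcm of r and q. If v is the cofactor of r, that of p is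
  uv, and S(uv) = S(v) S(u) leaves \<open>S u h\<close> as the new vector. This strips x from one
  argument.\<close>

lemma kform_mult:
  assumes carr: "p \<in> carrier G" "x \<in> carrier G" "r \<in> carrier G" "q \<in> carrier G" "u \<in> carrier G"
    and lcm: "is_lcm p x (x \<otimes> r)" and eq: "x \<otimes> r = p \<otimes> u"
  shows "kform p (x \<otimes> q) g h = kform r q g (S u h)"
proof -
  have inj: "inj_on ((\<otimes>) x) (carrier G)"
    using carr left_cancel by (auto intro: inj_onI)
  have iff: "is_lcm p (x \<otimes> q) (x \<otimes> s) \<longleftrightarrow> is_lcm r q s" if "s \<in> carrier G" for s
  proof -
    have "(x \<otimes> s) <#\<^bsub>G\<^esub> carrier G = (\<otimes>) x ` (s <#\<^bsub>G\<^esub> carrier G)"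
      using that carr by (auto simp: l_coset_def m_assoc)
    then show ?thesis
      unfolding is_lcm_def using that carr ideal_subset
      by (subst Int_ideal_mult[OF carr(1-4) lcm]) (simp add: inj_on_image_eq_iff[OF inj] le_infI1)
  qed
  show ?thesis
  proof (cases "\<exists>s. is_lcm r q s")
    case True
    then obtain v w where vw: "v \<in> carrier G" "w \<in> carrier G" "is_lcm r q (r \<otimes> v)" "r \<otimes> v = q \<otimes> w"
      using carr is_lcm_factor by metis
    have xrv: "x \<otimes> (r \<otimes> v) = p \<otimes> (u \<otimes> v)"
      using carr vw(1,2) eq by (simp flip: m_assoc)
    have "x \<otimes> (r \<otimes> v) = (x \<otimes> q) \<otimes> w"
      unfolding vw(4) using carr vw(1,2) by (simp add: m_assoc)
    then have eq': "p \<otimes> (u \<otimes> v) = (x \<otimes> q) \<otimes> w"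
      using xrv by simp
    have "is_lcm p (x \<otimes> q) (p \<otimes> (u \<otimes> v))"
      using iff[of "r \<otimes> v"] carr vw xrv by simp
    then have "kform p (x \<otimes> q) g h = cinner (S w g) (S (u \<otimes> v) h)"
      using carr vw(1,2) by (intro kform_lcm[OF _ _ _ _ _ eq']) simp_all
    also have "\<dots> = kform r q g (S u h)"
      using carr vw by (simp add: kform_lcm[of r q v w] S_mult)
    finally show ?thesis .
  next
    case False
    \<comment> \<open>An lcm of p and xq is some xqw, and cancelling x would make qw an lcm of r and
      q.\<close>
    have "\<not> is_lcm p (x \<otimes> q) s" for s
    proof
      assume s: "is_lcm p (x \<otimes> q) s"
      then obtain w where "w \<in> carrier G" "s = (x \<otimes> q) \<otimes> w"
        using carr is_lcm_factor[of p "x \<otimes> q" s] by (metis m_closed)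
      then have "is_lcm r q (q \<otimes> w)"
        using s iff[of "q \<otimes> w"] carr by (simp add: m_assoc)
      then show False
        using False by blast
    qed
    then show ?thesis
      using False by (simp add: kform_no_lcm)
  qed
qed

text \<open>The lcm of xp and x is xp itself, so \<open>kform_mult\<close> applies with r = p and u
  the identity.\<close>

lemma kform_mult_left:
  assumes "p \<in> carrier G" "q \<in> carrier G" "x \<in> carrier G"
  shows "kform (x \<otimes> p) (x \<otimes> q) g h = kform p q g h"
  using kform_mult[of "x \<otimes> p" x p q \<one>] is_lcm_mult[of x p] assms by (simp add: is_lcm_commute)

lemma kform_disjoint:
  assumes "p \<in> carrier G" "q \<in> carrier G" "(p <#\<^bsub>G\<^esub> carrier G) \<inter> (q <#\<^bsub>G\<^esub> carrier G) = {}"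
  shows "kform p q g h = 0"
  using assms self_mem_ideal by (intro kform_no_lcm) (auto simp: is_lcm_def)

end

section \<open>Inclusion-exclusion sums over power sets\<close>

lemma sum_Pow_insert:
  fixes f :: "'a set \<Rightarrow> 'b::comm_monoid_add"
  assumes "finite A" "a \<notin> A"
  shows "(\<Sum>U\<in>Pow (insert a A). f U) = (\<Sum>U\<in>Pow A. f U) + (\<Sum>U\<in>Pow A. f (insert a U))"
proof -
  have "inj_on (insert a) (Pow A)"
    using assms(2) by (auto simp: inj_on_def)
  moreover have "Pow A \<inter> insert a ` Pow A = {}"
    using assms(2) by auto
  ultimately show ?thesis
    using assms(1) by (simp add: Pow_insert sum.union_disjoint sum.reindex)
qed

text \<open>Serves families with pairwise disjoint right ideals: only the empty set and the
  singletons contribute.\<close>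

lemma alternating_sum_Pow:
  fixes f :: "'a set \<Rightarrow> complex"
  assumes "finite A" and zero: "\<And>U x y. U \<subseteq> A \<Longrightarrow> x \<in> U \<Longrightarrow> y \<in> U \<Longrightarrow> x \<noteq> y \<Longrightarrow> f U = 0"
  shows "(\<Sum>U\<in>Pow A. (- 1) ^ card U * f U) = f {} - (\<Sum>x\<in>A. f {x})"
proof -
  have "f U = 0" if "U \<in> Pow A - insert {} ((\<lambda>x. {x}) ` A)" for U
  proof -
    obtain x where "x \<in> U"
      using \<open>U \<in> _\<close> by blast
    moreover then obtain y where "y \<in> U" "x \<noteq> y"
      using \<open>U \<in> _\<close> by blast
    ultimately show ?thesis
      using that zero[of U x y] by blast
  qed
  then have "(\<Sum>U\<in>Pow A. (- 1) ^ card U * f U)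
      = (\<Sum>U\<in>insert {} ((\<lambda>x. {x}) ` A). (- 1) ^ card U * f U)"
    using assms(1) by (intro sum.mono_neutral_right) auto
  also have "\<dots> = f {} - (\<Sum>x\<in>A. f {x})"
    using assms(1) by (subst sum.insert) (auto simp: sum.reindex sum_negf)
  finally show ?thesis .
qed

context conical_rep
begin

lemma TTstar_vee_singleton: "p \<in> carrier G \<Longrightarrow> TTstar_vee G T {p} = TTstar T p"
  by (simp add: TTstar_vee_def vee_singleton)

lemma TTstar_vee_pair: "is_lcm p q r \<Longrightarrow> TTstar_vee G T {p, q} = TTstar T r"
  by (simp add: TTstar_vee_def vee_pair_lcm)

lemma TTstar_vee_disjoint:
  assumes "p \<in> U" "q \<in> U" "(p <#\<^bsub>G\<^esub> carrier G) \<inter> (q <#\<^bsub>G\<^esub> carrier G) = {}"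
  shows "TTstar_vee G T U = 0"
proof -
  have "(\<Inter>x\<in>U. x <#\<^bsub>G\<^esub> carrier G) = {}"
    using assms by blast
  then have "r \<notin> vee G U" for r
    using assms(1) self_mem_ideal[of r] by (auto simp: vee_def)
  then have "vee G U = {}"
    by blast
  then show ?thesis
    using assms(1) by (auto simp: TTstar_vee_def)
qed

lemma cinner_Z:
  "cinner (Z G T F h) h = (\<Sum>U\<in>Pow F. (- 1) ^ card U * cinner (TTstar_vee G T U h) h)"
  by (simp add: Z_def blinfun.sum_left blinfun.scaleR_left cinner_sum_left cinner_scaleR_left)

end

section \<open>Defect operator and the conditions on \<open>Z\<close>\<close>

locale bs_rep = bs_monoid n m for n m +
  fixes T :: "bs_gen list set \<Rightarrow> 'h::chilbert_space \<Rightarrow>\<^sub>L 'h"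
  assumes bs_rep: "contractive_rep (BS n m) T"
begin

sublocale conical_rep "BS n m" T
  using left_cancel_P conical_P bs_rep by unfold_locales

section \<open>Least common multiples of b^k and b^i a\<close>

definition coff :: "nat \<Rightarrow> nat \<Rightarrow> nat"
  where "coff i k = (i + (m - k mod m)) mod m"

text \<open>For i < m the equation b^k b^u a = b^i a b^{nc} is solved by u =
  \<open>coff i k\<close>, the residue of i - k modulo m, and c = \<open>cquot i k\<close>.\<close>

definition cquot :: "nat \<Rightarrow> nat \<Rightarrow> nat"
  where "cquot i k = (coff i k + k) div m"

lemma coff_less: "coff i k < m"
  using m_pos by (simp add: coff_def)

lemma coff_add:
  assumes "i < m"
  shows "coff i k + k = i + m * cquot i k"
proof -
  have "(coff i k + k) mod m = i"
    using add_compl_mod[OF m_pos, of i k] assms by (simp add: coff_def mod_simps)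
  then show ?thesis
    unfolding cquot_def by (metis mod_mult_div_eq)
qed

lemma add_coff_mod: "i < m \<Longrightarrow> (k + coff i k) mod m = i"
  using coff_add[of i k] by (metis add.commute mod_less mod_mult_self2)

lemma coff_unique:
  assumes "j < m" "(k + j) mod m = i"
  shows "coff i k = j"
proof (rule add_mod_cancel)
  have "i < m"
    using assms(2) m_pos by auto
  then show "(k + coff i k) mod m = (k + j) mod m"
    using assms(2) by (simp add: add_coff_mod)
qed (simp_all add: coff_less assms(1))

text \<open>This permutation of residues later turns a sum over the components i into the sum over u
  in the defect.\<close>

lemma coff_bij: "bij_betw (\<lambda>i. coff i k) {..<m} {..<m}"
proof (rule bij_betw_byWitness)
  show "\<forall>i\<in>{..<m}. (k + coff i k) mod m = i"
    using add_coff_mod by simp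
  show "\<forall>j\<in>{..<m}. coff ((k + j) mod m) k = j"
    using coff_unique by simp
qed (use m_pos coff_less in auto)

lemma bpa_coff: "i < m \<Longrightarrow> bpa i \<otimes>\<^bsub>P\<^esub> bp (n * cquot i k) = bp k \<otimes>\<^bsub>P\<^esub> bpa (coff i k)"
  using coff_add[of i k] by (simp add: bpa_bp bp_bpa add.commute)

text \<open>If b^k x = b^i a z, uniqueness of normal forms makes x begin with a syllable whose digit
  is forced to be \<open>coff i k\<close>. So every common multiple is a multiple of b^k b^u a with
  this u.\<close>

lemma is_lcm_bp_bpa:
  assumes "i < m"
  shows "is_lcm (bp k) (bpa i) (bpa i \<otimes>\<^bsub>P\<^esub> bp (n * cquot i k))"
proof -
  have "y \<in> (bp k \<otimes>\<^bsub>P\<^esub> bpa (coff i k)) <#\<^bsub>P\<^esub> carrier P"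
    if y: "y \<in> bp k <#\<^bsub>P\<^esub> carrier P" "y \<in> bpa i <#\<^bsub>P\<^esub> carrier P" for y
  proof -
    obtain x z where xz: "valid x" "y = bp k \<otimes>\<^bsub>P\<^esub> val x" "valid z" "y = bpa i \<otimes>\<^bsub>P\<^esub> val z"
      using y by (metis mem_ideal_iff carrierE)
    then have "val (shift x k) = val (Syll i z)"
      by (simp add: bp_val val_Syll)
    then have eq: "shift x k = Syll i z"
      using xz assms by (simp add: val_eq_iff)
    then obtain j w where x: "x = Syll j w"
      by (cases x) simp_all
    then have "coff i k = j"
      using eq xz by (intro coff_unique) simp_all
    then have "y = (bp k \<otimes>\<^bsub>P\<^esub> bpa (coff i k)) \<otimes>\<^bsub>P\<^esub> val w"
      using xz by (simp add: x val_Syll m_assoc)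
    then show ?thesis
      by simp
  qed
  moreover have "(bp k \<otimes>\<^bsub>P\<^esub> bpa (coff i k)) <#\<^bsub>P\<^esub> carrier P \<subseteq> bp k <#\<^bsub>P\<^esub> carrier P"
    by (simp add: ideal_mult_subset)
  moreover have "(bp k \<otimes>\<^bsub>P\<^esub> bpa (coff i k)) <#\<^bsub>P\<^esub> carrier P \<subseteq> bpa i <#\<^bsub>P\<^esub> carrier P"
    unfolding bpa_coff[OF assms, symmetric] by (simp add: ideal_mult_subset)
  ultimately show ?thesis
    unfolding is_lcm_def bpa_coff[OF assms] by blast
qed

text \<open>The first digit of the normal form tells the ideals apart.\<close>

lemma bpa_disjoint:
  assumes "i < m" "j < m" "i \<noteq> j"
  shows "(bpa i <#\<^bsub>P\<^esub> carrier P) \<inter> (bpa j <#\<^bsub>P\<^esub> carrier P) = {}"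
proof -
  have "bpa i \<otimes>\<^bsub>P\<^esub> q \<noteq> bpa j \<otimes>\<^bsub>P\<^esub> r" if qr: "q \<in> carrier P" "r \<in> carrier P" for q r
  proof -
    obtain x y where "valid x" "q = val x" "valid y" "r = val y"
      using qr by (metis carrierE)
    then show ?thesis
      using assms by (simp add: val_eq_iff flip: val_Syll)
  qed
  then show ?thesis
    by (auto simp: mem_ideal_iff)
qed

lemma TTstar_vee_two_bpa:
  assumes "i < m" "j < m" "bpa i \<noteq> bpa j" "bpa i \<in> U" "bpa j \<in> U"
  shows "TTstar_vee P T U = 0"
  using assms by (intro TTstar_vee_disjoint[of "bpa i" U "bpa j"] bpa_disjoint) auto

lemma bpa_inj: "inj_on bpa {..<m}"
  using bpa_disjoint self_mem_ideal by (fastforce simp: inj_on_def)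

lemma bp_1_neq_bpa: "i < m \<Longrightarrow> bp 1 \<noteq> bpa i"
  using val_eq_iff[of "BPow 1" "Syll i (BPow 0)"] by (simp add: val_Syll)

lemma bs_P00: "P00 n m = insert (bp 1) (bpa ` {..<m})"
proof -
  have b: "bs_b n m = bp 1"
    by (simp add: bs_b_def bp_def)
  have "bs_b n m [^]\<^bsub>P\<^esub> k = bp k" for k :: nat
    by (induction k) (simp_all add: b bp_add)
  moreover have "bs_a n m = bpa 0"
    by (simp add: bs_a_def bpa_def)
  ultimately show ?thesis
    by (auto simp: P00_def b bp_bpa)
qed

lemma is_lcm_b_a: "is_lcm (bp 1) (bpa 0) (bpa m)"
proof -
  \<comment> \<open>The residue of -1 modulo m, also for m = 1, where both sides are 0. It makes the
    lcm equal to b b^{m-1} a.\<close>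
  have "coff 0 1 = m - 1"
    using m_pos coff_less[of 0 1] by (cases "m = 1") (simp, simp add: coff_def)
  then have "bpa m = bp 1 \<otimes>\<^bsub>P\<^esub> bpa (coff 0 1)"
    using m_pos by (simp add: bp_bpa)
  then show ?thesis
    using is_lcm_bp_bpa[OF m_pos, of 1] by (simp add: bpa_coff[OF m_pos])
qed

lemma bpa_Suc: "bp 1 \<otimes>\<^bsub>P\<^esub> bpa i = bpa (Suc i)"
  by (simp add: bp_bpa)

section \<open>Quadratic forms of \<open>Z\<close> and of the defect\<close>

definition zq :: "bs_gen list set \<Rightarrow> 'h \<Rightarrow> complex"
  where "zq p h = cinner (S p h) (S p h)"

lemma zq_nonneg: "0 \<le> zq p h"
  by (simp add: zq_def cinner_ge_zero)

lemma cinner_Z_bpa: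
  assumes "I \<subseteq> {..<m}"
  shows "cinner (Z P T (bpa ` I) h) h = cinner h h - (\<Sum>i\<in>I. zq (bpa i) h)"
proof -
  have fin: "finite (bpa ` I)"
    using assms finite_subset by blast
  have "cinner (Z P T (bpa ` I) h) h =
      cinner (TTstar_vee P T {} h) h - (\<Sum>x\<in>bpa ` I. cinner (TTstar_vee P T {x} h) h)"
    unfolding cinner_Z
  proof (rule alternating_sum_Pow[OF fin])
    fix U x y
    assume "U \<subseteq> bpa ` I" "x \<in> U" "y \<in> U" "x \<noteq> y"
    moreover from this obtain i j where "i \<in> I" "x = bpa i" "j \<in> I" "y = bpa j"
      by blast
    ultimately have "TTstar_vee P T U = 0"
      using assms by (intro TTstar_vee_two_bpa[of i j]) auto
    then show "cinner (TTstar_vee P T U h) h = 0"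
      by simp
  qed
  also have "\<dots> = cinner h h - (\<Sum>i\<in>I. zq (bpa i) h)"
    using inj_on_subset[OF bpa_inj assms]
    by (simp add: TTstar_vee_singleton cinner_TTstar zq_def sum.reindex) (simp add: TTstar_vee_def)
  finally show ?thesis .
qed

text \<open>For i > 0 the element b^i a is a multiple of b, so the terms of {b^i a} and {b, b^i a}
  cancel. Only a itself has a new lcm with b, namely b^m a.\<close>

lemma cinner_Z_insert_b:
  assumes "I \<subseteq> {..<m}"
  shows "cinner (Z P T (insert (bp 1) (bpa ` I)) h) h =
    cinner h h - zq (bp 1) h - (if 0 \<in> I then zq (bpa 0) h - zq (bpa m) h else 0)"
proof -
  have fin: "finite I"
    using assms finite_subset by blast
  have b: "bp 1 \<notin> bpa ` I"
    using bp_1_neq_bpa assms by blast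
  let ?w = "\<lambda>i. if i = 0 then zq (bpa m) h else zq (bpa i) h"
  have vee: "cinner (TTstar_vee P T {bp 1, bpa i} h) h = ?w i" if "i \<in> I" for i
  proof -
    have "is_lcm (bp 1) (bpa i) (if i = 0 then bpa m else bpa i)"
      using is_lcm_b_a is_lcm_mult[of "bp 1" "bpa (i - 1)"] bpa_Suc[of "i - 1"] by auto
    from TTstar_vee_pair[OF this] show ?thesis
      by (simp add: cinner_TTstar zq_def)
  qed
  have "(\<Sum>U\<in>Pow (bpa ` I). (- 1) ^ card U * cinner (TTstar_vee P T (insert (bp 1) U) h) h) =
      cinner (TTstar_vee P T {bp 1} h) h
        - (\<Sum>x\<in>bpa ` I. cinner (TTstar_vee P T (insert (bp 1) {x}) h) h)"
  proof (rule alternating_sum_Pow)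
    fix U x y
    assume "U \<subseteq> bpa ` I" "x \<in> U" "y \<in> U" "x \<noteq> y"
    moreover from this obtain i j where "i \<in> I" "x = bpa i" "j \<in> I" "y = bpa j"
      by blast
    ultimately have "TTstar_vee P T (insert (bp 1) U) = 0"
      using assms by (intro TTstar_vee_two_bpa[of i j]) auto
    then show "cinner (TTstar_vee P T (insert (bp 1) U) h) h = 0"
      by simp
  qed (use fin in simp)
  also have "\<dots> = zq (bp 1) h - (\<Sum>i\<in>I. ?w i)"
    using inj_on_subset[OF bpa_inj assms]
    by (simp add: TTstar_vee_singleton cinner_TTstar zq_def sum.reindex vee cong: sum.cong
        del: One_nat_def)
  finally have sum_b: "(\<Sum>U\<in>Pow (bpa ` I).
        (- 1) ^ card U * cinner (TTstar_vee P T (insert (bp 1) U) h) h) =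
      zq (bp 1) h - (\<Sum>i\<in>I. ?w i)" .
  \<comment> \<open>Adjoining b raises the cardinality by one and flips the sign.\<close>
  have "(\<Sum>U\<in>Pow (bpa ` I). (- 1) ^ card U * cinner (TTstar_vee P T (insert (bp 1) U) h) h) =
      - (\<Sum>U\<in>Pow (bpa ` I). (- 1) ^ card (insert (bp 1) U) *
          cinner (TTstar_vee P T (insert (bp 1) U) h) h)"
    unfolding sum_negf[symmetric]
  proof (rule sum.cong[OF HOL.refl])
    fix U assume "U \<in> Pow (bpa ` I)"
    then have "finite U" "bp 1 \<notin> U"
      using finite_subset[OF _ finite_imageI[OF fin]] b by auto
    then show "(- 1) ^ card U * cinner (TTstar_vee P T (insert (bp 1) U) h) h =
        - ((- 1) ^ card (insert (bp 1) U) * cinner (TTstar_vee P T (insert (bp 1) U) h) h)"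
      by simp
  qed
  then have "cinner (Z P T (insert (bp 1) (bpa ` I)) h) h =
      cinner (Z P T (bpa ` I) h) h - (zq (bp 1) h - (\<Sum>i\<in>I. ?w i))"
    unfolding cinner_Z sum_Pow_insert[OF finite_imageI[OF fin] b] sum_b[symmetric] by simp
  also have "\<dots> = cinner h h - zq (bp 1) h - (\<Sum>i\<in>I. if i = 0 then zq (bpa 0) h - zq (bpa m) h else 0)"
  proof -
    have "(\<Sum>i\<in>I. ?w i) - (\<Sum>i\<in>I. zq (bpa i) h) =
        - (\<Sum>i\<in>I. if i = 0 then zq (bpa 0) h - zq (bpa m) h else 0)"
      unfolding sum_subtractf[symmetric] sum_negf[symmetric] by (intro sum.cong) auto
    then show ?thesis
      by (simp add: cinner_Z_bpa[OF assms] algebra_simps)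
  qed
  also have "(\<Sum>i\<in>I. if i = 0 then zq (bpa 0) h - zq (bpa m) h else 0) =
      (if 0 \<in> I then zq (bpa 0) h - zq (bpa m) h else 0)"
    using fin by (simp add: sum.delta)
  finally show ?thesis .
qed

definition defect :: "'h \<Rightarrow> 'h \<Rightarrow> complex"
  where "defect g h = cinner g h - (\<Sum>u<m. cinner (S (bpa u) g) (S (bpa u) h))"

lemma defect_self: "defect h h = cinner h h - (\<Sum>i<m. zq (bpa i) h)"
  by (simp add: defect_def zq_def)

text \<open>S(b^u a) S(b) = S(b^{u+1} a), so the two sums over u overlap except at the ends 0 and m.
  The right side is the quadratic form of Z({b, a}) from \<open>cinner_Z_insert_b\<close>.\<close>

lemma defect_diff:
  "defect h h - defect (S (bp 1) h) (S (bp 1) h) =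
    cinner h h - zq (bp 1) h - (zq (bpa 0) h - zq (bpa m) h)"
proof -
  have "zq (bpa i) (S (bp 1) h) = zq (bpa (Suc i)) h" for i
    by (simp add: zq_def S_mult flip: bpa_Suc)
  then show ?thesis
    using sum.lessThan_Suc_shift[of "\<lambda>i. zq (bpa i) h" m] sum.lessThan_Suc[of "\<lambda>i. zq (bpa i) h" m]
    by (simp add: defect_self zq_def[of "bp (Suc 0)"] algebra_simps)
qed

definition defect_conditions :: bool
  where "defect_conditions \<longleftrightarrow>
    (\<forall>h. 0 \<le> defect h h \<and> defect (S (bp 1) h) (S (bp 1) h) \<le> defect h h)"

text \<open>Two sets yield the conditions: all b^i a together, and {b, a}. Conversely, a set without
  b subtracts only some of the nonnegative terms of the defect, and a set with b depends only on
  whether a belongs to it.\<close>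

lemma positive_Z_iff:
  "(\<forall>F. finite F \<and> F \<subseteq> P00 n m \<longrightarrow> positive_op (Z P T F)) \<longleftrightarrow> defect_conditions"
proof
  assume pos: "\<forall>F. finite F \<and> F \<subseteq> P00 n m \<longrightarrow> positive_op (Z P T F)"
  have zero: "{0} \<subseteq> {..<m}"
    using m_pos by simp
  have Z: "0 \<le> cinner (Z P T (bpa ` {..<m}) h) h"
    "0 \<le> cinner (Z P T (insert (bp 1) (bpa ` {0})) h) h" for h
    using pos m_pos unfolding positive_op_def bs_P00 by auto
  have "0 \<le> defect h h" for h
    using Z(1)[of h] unfolding cinner_Z_bpa[OF subset_refl] defect_self .
  moreover have "0 \<le> defect h h - defect (S (bp 1) h) (S (bp 1) h)" for h
    using Z(2)[of h] unfolding cinner_Z_insert_b[OF zero] defect_diff by simp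
  ultimately show defect_conditions
    by (simp add: defect_conditions_def)
next
  assume dc: defect_conditions
  show "\<forall>F. finite F \<and> F \<subseteq> P00 n m \<longrightarrow> positive_op (Z P T F)"
  proof (intro allI impI)
    fix F assume "finite F \<and> F \<subseteq> P00 n m"
    then have F: "F \<subseteq> insert (bp 1) (bpa ` {..<m})"
      by (simp add: bs_P00)
    then have "F - {bp 1} \<subseteq> bpa ` {..<m}"
      by blast
    then obtain I where I: "I \<subseteq> {..<m}" "F - {bp 1} = bpa ` I"
      by (meson subset_image_iff)
    show "positive_op (Z P T F)"
      unfolding positive_op_def
    proof
      fix h
      show "0 \<le> cinner (Z P T F h) h"
      proof (cases "bp 1 \<in> F")
        case True
        then have F': "F = insert (bp 1) (bpa ` I)"
          using I by blast
        \<comment> \<open>Contractivity of T(b)^* settles the sets that contain b but not a.\<close>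
        have "0 \<le> cinner h h - zq (bp 1) h"
          using cinner_S_le[of "bp 1" h] by (simp add: zq_def)
        moreover have "0 \<le> cinner h h - zq (bp 1) h - (zq (bpa 0) h - zq (bpa m) h)"
          using dc unfolding defect_diff[symmetric] by (simp add: defect_conditions_def)
        ultimately show ?thesis
          unfolding F' cinner_Z_insert_b[OF I(1)] by simp
      next
        case False
        then have F': "F = bpa ` I"
          using I by blast
        have "(\<Sum>i\<in>I. zq (bpa i) h) \<le> (\<Sum>i<m. zq (bpa i) h)"
          using I by (intro sum_mono2) (simp_all add: zq_nonneg)
        also have "\<dots> \<le> cinner h h"
          using dc by (simp add: defect_conditions_def defect_self)
        finally show ?thesis
          by (simp add: F' cinner_Z_bpa[OF I(1)])
      qed
    qed
  qed
qed

lemma star_regular_iff: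
  "star_regular P T \<longleftrightarrow> (\<forall>(k::nat) p h. (\<forall>i<k. p i \<in> carrier P) \<longrightarrow>
    0 \<le> (\<Sum>i<k. \<Sum>j<k. kform (p i) (p j) (h j) (h i)))"
  by (simp add: star_regular_def completely_positive_definite_def cinner_sum_left kform_def)

end

section \<open>Decomposition of the regular kernel\<close>

primrec nf_depth :: "bs_nf \<Rightarrow> nat" where
  "nf_depth (BPow k) = 0"
| "nf_depth (Syll i x) = Suc (nf_depth x)"

text \<open>Selects the entries that are powers of b. All others receive the vector 0 from
  \<open>nf_pow_vec\<close>, which makes their exponent 0 a mere placeholder.\<close>

primrec nf_pow :: "bs_nf \<Rightarrow> nat" where
  "nf_pow (BPow k) = k"
| "nf_pow (Syll i x) = 0"

primrec nf_pow_vec :: "bs_nf \<Rightarrow> 'h \<Rightarrow> 'h::zero" where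
  "nf_pow_vec (BPow k) h = h"
| "nf_pow_vec (Syll i x) h = 0"

context bs_rep
begin

text \<open>Mismatched syllables stay as the identity with vector 0, so that each component family
  keeps the index set of the original one.\<close>

primrec nf_comp :: "nat \<Rightarrow> bs_nf \<Rightarrow> bs_nf" where
  "nf_comp i (BPow k) = BPow (n * cquot i k)"
| "nf_comp i (Syll j x) = (if i = j then x else BPow 0)"

primrec nf_comp_vec :: "nat \<Rightarrow> bs_nf \<Rightarrow> 'h \<Rightarrow> 'h" where
  "nf_comp_vec i (BPow k) h = S (bpa (coff i k)) h"
| "nf_comp_vec i (Syll j x) h = (if i = j then h else 0)"

lemma S_bp_funpow: "S (bp k) h = (S (bp 1) ^^ k) h"
proof (induction k)
  case (Suc k)
  have "S (bp (Suc k)) h = S (bp 1) (S (bp k) h)"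
    using S_mult[of "bp k" "bp 1" h] by (simp add: bp_add)
  then show ?case
    using Suc.IH by simp
qed simp

lemma toeplitz_cinner: "kform (bp k) (bp l) g h = toeplitz_form cinner (S (bp 1)) k l g h"
proof -
  have le: "kform (bp k) (bp l) g h = cinner g (S (bp (l - k)) h)" if "k \<le> l" for k l g h
    using that kform_dvd[of "bp k" "bp (l - k)" g h] by (simp add: bp_add)
  show ?thesis
  proof (cases "k \<le> l")
    case True
    then show ?thesis
      by (simp add: le toeplitz_form_def S_bp_funpow)
  next
    case False
    then have "kform (bp k) (bp l) g h = cinner (S (bp (k - l)) g) h"
      using le[of l k h g] kform_commute[of "bp l" "bp k" g h]
        cinner_commute[of "S (bp (k - l)) g" h] by simp
    then show ?thesis
      using False by (simp add: toeplitz_form_def S_bp_funpow)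
  qed
qed

text \<open>With k \<le> l the powers in component i divide one another, which makes its kernel an
  inner product. The relation then brings each term to the index u = \<open>coff i l\<close>, and
  \<open>coff_bij\<close> reindexes the sum.\<close>

lemma sum_kform_pow:
  assumes "k \<le> l"
  shows "(\<Sum>i<m. kform (bp (n * cquot i k)) (bp (n * cquot i l))
      (S (bpa (coff i l)) g) (S (bpa (coff i k)) h)) =
    (\<Sum>u<m. cinner (S (bpa u) g) (S (bpa u) (S (bp (l - k)) h)))"
proof -
  have "kform (bp (n * cquot i k)) (bp (n * cquot i l)) (S (bpa (coff i l)) g) (S (bpa (coff i k)) h) =
      cinner (S (bpa (coff i l)) g) (S (bpa (coff i l)) (S (bp (l - k)) h))" if "i < m" for i
  proof -
    have k: "coff i k + k = i + m * cquot i k" and l: "coff i l + l = i + m * cquot i l"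
      using that coff_add by blast+
    \<comment> \<open>A larger quotient at k would exceed the one at l by a full m, forcing
      \<open>coff i k\<close> to be at least m.\<close>
    have le: "cquot i k \<le> cquot i l"
    proof (rule ccontr)
      assume "\<not> cquot i k \<le> cquot i l"
      then have "m * Suc (cquot i l) \<le> m * cquot i k"
        by (intro mult_le_mono2) simp
      then show False
        using k l assms coff_less[of i k] by simp
    qed
    define d where "d = cquot i l - cquot i k"
    have d: "cquot i l = cquot i k + d"
      using le by (simp add: d_def)
    \<comment> \<open>The difference of the two \<open>coff_add\<close> equations, written without
      subtraction except l - k; it becomes a relation in the monoid.\<close>
    have "coff i k + m * d = (l - k) + coff i l"
      using k l assms by (simp add: d distrib_left)
    then have eq: "bpa (coff i k) \<otimes>\<^bsub>P\<^esub> bp (n * d) = bp (l - k) \<otimes>\<^bsub>P\<^esub> bpa (coff i l)"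
      by (simp add: bpa_bp bp_bpa)
    have "bp (n * cquot i l) = bp (n * cquot i k) \<otimes>\<^bsub>P\<^esub> bp (n * d)"
      by (simp add: bp_add d distrib_left)
    then have "kform (bp (n * cquot i k)) (bp (n * cquot i l)) (S (bpa (coff i l)) g) (S (bpa (coff i k)) h) =
        cinner (S (bpa (coff i l)) g) (S (bp (n * d)) (S (bpa (coff i k)) h))"
      by (simp add: kform_dvd)
    also have "S (bp (n * d)) (S (bpa (coff i k)) h) = S (bpa (coff i l)) (S (bp (l - k)) h)"
      by (simp add: eq flip: S_mult)
    finally show ?thesis .
  qed
  then have "(\<Sum>i<m. kform (bp (n * cquot i k)) (bp (n * cquot i l))
      (S (bpa (coff i l)) g) (S (bpa (coff i k)) h)) =
      (\<Sum>i<m. cinner (S (bpa (coff i l)) g) (S (bpa (coff i l)) (S (bp (l - k)) h)))"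
    by simp
  also have "\<dots> = (\<Sum>u<m. cinner (S (bpa u) g) (S (bpa u) (S (bp (l - k)) h)))"
    by (rule sum.reindex_bij_betw[OF coff_bij])
  finally show ?thesis .
qed

text \<open>For k \<le> l the m component kernels add up to exactly what the defect subtracts from
  the inner product. The other case follows by Hermitian symmetry.\<close>

lemma kform_pow_decomposition:
  "kform (bp k) (bp l) g h =
    (\<Sum>i<m. kform (bp (n * cquot i k)) (bp (n * cquot i l))
      (S (bpa (coff i l)) g) (S (bpa (coff i k)) h)) + toeplitz_form defect (S (bp 1)) k l g h"
proof -
  define R where "R k l g h = (\<Sum>i<m. kform (bp (n * cquot i k)) (bp (n * cquot i l))
      (S (bpa (coff i l)) g) (S (bpa (coff i k)) h))" for k l g h
  have le: "kform (bp k) (bp l) g h = R k l g h + toeplitz_form defect (S (bp 1)) k l g h"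
    if "k \<le> l" for k l g h
    unfolding R_def sum_kform_pow[OF that]
    using that by (simp add: toeplitz_cinner toeplitz_form_def defect_def S_bp_funpow)
  have commute: "kform (bp x) (bp y) g h = cnj (kform (bp y) (bp x) h g)" for x y g h
    by (intro kform_commute) simp_all
  have R_commute: "R k l g h = cnj (R l k h g)"
    unfolding R_def cnj_sum by (intro sum.cong HOL.refl commute)
  have defect_commute: "cnj (defect y x) = defect x y" for x y
    by (simp add: defect_def flip: cinner_commute)
  have "kform (bp k) (bp l) g h = R k l g h + toeplitz_form defect (S (bp 1)) k l g h"
  proof (cases "k \<le> l")
    case False
    then have "toeplitz_form defect (S (bp 1)) k l g h = cnj (toeplitz_form defect (S (bp 1)) l k h g)"
      by (simp add: toeplitz_form_def defect_commute)
    then show ?thesis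
      using False unfolding commute[of k l] R_commute by (simp add: le)
  qed (rule le)
  then show ?thesis
    by (simp only: R_def)
qed

lemma kform_pow_Syll:
  assumes "j < m" "valid y"
  shows "kform (bp k) (val (Syll j y)) g h =
    kform (bp (n * cquot j k)) (val y) g (S (bpa (coff j k)) h)"
  unfolding val_Syll using assms is_lcm_bp_bpa bpa_coff by (intro kform_mult) simp_all

text \<open>Unless both entries are powers of b, one of the vectors in the Toeplitz term is 0, and
  at most the component of a leading syllable survives, where \<open>kform_pow_Syll\<close> or
  \<open>kform_mult_left\<close> strips that syllable.\<close>

lemma kform_decomposition:
  assumes "valid x" "valid y"
  shows "kform (val x) (val y) g h =
    (\<Sum>i<m. kform (val (nf_comp i x)) (val (nf_comp i y)) (nf_comp_vec i y g) (nf_comp_vec i x h)) +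
    toeplitz_form defect (S (bp 1)) (nf_pow x) (nf_pow y) (nf_pow_vec y g) (nf_pow_vec x h)"
proof -
  have S_0: "(S (bp 1) ^^ k) 0 = 0" for k
    by (induction k) simp_all
  have toep_0: "toeplitz_form defect (S (bp 1)) k l 0 h = 0" "toeplitz_form defect (S (bp 1)) k l h 0 = 0"
    for k l h
    using S_0 by (simp_all add: toeplitz_form_def defect_def)
  have only: "(\<Sum>i<m. f i) = f j" if "j < m" "\<And>i. i \<noteq> j \<Longrightarrow> f i = 0" for f :: "nat \<Rightarrow> complex" and j
    using that by (subst sum.remove[of _ j]) simp_all
  show ?thesis
  proof (cases x)
    case x: (BPow k)
    show ?thesis
    proof (cases y)
      case (BPow l)
      show ?thesis
        unfolding x BPow val_BPow nf_comp.simps nf_comp_vec.simps nf_pow.simps nf_pow_vec.simps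
        by (rule kform_pow_decomposition)
    next
      case (Syll j y')
      then show ?thesis
        using x assms by (simp add: toep_0 kform_pow_Syll del: One_nat_def) (subst only[of j], simp_all)
    qed
  next
    case x: (Syll i x')
    show ?thesis
    proof (cases y)
      case (BPow l)
      have "kform (val x) (val y) g h = cnj (kform (bp l) (val (Syll i x')) h g)"
        using kform_commute[of "bp l" "val x" g h] by (simp add: x BPow)
      also have "\<dots> = kform (val x') (bp (n * cquot i l)) (S (bpa (coff i l)) g) h"
        using assms x kform_commute[of "bp (n * cquot i l)" "val x'"] by (simp add: kform_pow_Syll)
      finally show ?thesis
        using x BPow assms by (simp add: toep_0 del: One_nat_def) (subst only[of i], simp_all)
    next
      case y: (Syll j y')
      show ?thesis
      proof (cases "i = j")
        case True
        then show ?thesis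
          using x y assms by (simp add: toep_0 val_Syll kform_mult_left del: One_nat_def) (subst only[of j], simp_all)
      next
        case False
        \<comment> \<open>In every component one of the two vectors is 0, so the right side vanishes
          as well.\<close>
        have "kform (val x) (val y) g h = 0"
        proof (rule kform_disjoint)
          have "(val x <#\<^bsub>P\<^esub> carrier P) \<subseteq> bpa i <#\<^bsub>P\<^esub> carrier P"
            "(val y <#\<^bsub>P\<^esub> carrier P) \<subseteq> bpa j <#\<^bsub>P\<^esub> carrier P"
            by (simp_all add: x y val_Syll ideal_mult_subset)
          then show "(val x <#\<^bsub>P\<^esub> carrier P) \<inter> (val y <#\<^bsub>P\<^esub> carrier P) = {}"
            using bpa_disjoint[of i j] assms x y False by auto
        qed simp_all
        then show ?thesis
          using x y False by (simp add: toep_0 del: One_nat_def) (rule sum.neutral, simp)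
      qed
    qed
  qed
qed

lemma nf_comp_valid: "valid x \<Longrightarrow> valid (nf_comp i x)"
  by (cases x) simp_all

lemma nf_comp_depth: "nf_depth x \<le> Suc d \<Longrightarrow> nf_depth (nf_comp i x) \<le> d"
  by (cases x) simp_all

lemma cinner_contracted: "contracted_form cinner (S (bp 1))"
  by unfold_locales
    (simp_all add: cinner_add_left cinner_add_right S_add cinner_ge_zero cinner_S_le del: One_nat_def)

lemma defect_contracted: "defect_conditions \<Longrightarrow> contracted_form defect (S (bp 1))"
  by unfold_locales
    (simp_all add: defect_def defect_conditions_def cinner_add_left cinner_add_right S_add
      sum.distrib del: One_nat_def)

text \<open>Stated for indexed families because different entries may share a component. Components
  of powers are again powers, so depth drops to the base case of powers of b, a Toeplitz kernel of
  the inner product.\<close>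

lemma kform_nonneg:
  fixes x :: "'i \<Rightarrow> bs_nf" and h :: "'i \<Rightarrow> 'h"
  assumes dc: defect_conditions and J: "finite J"
    and "\<And>j. j \<in> J \<Longrightarrow> valid (x j)" "\<And>j. j \<in> J \<Longrightarrow> nf_depth (x j) \<le> d"
  shows "0 \<le> (\<Sum>j\<in>J. \<Sum>l\<in>J. kform (val (x j)) (val (x l)) (h l) (h j))"
  using assms(3,4)
proof (induction d arbitrary: x h)
  case 0
  have "val (x j) = bp (nf_pow (x j))" if "j \<in> J" for j
    using 0(2)[OF that] by (cases "x j") simp_all
  then have "(\<Sum>j\<in>J. \<Sum>l\<in>J. kform (val (x j)) (val (x l)) (h l) (h j)) =
      (\<Sum>j\<in>J. \<Sum>l\<in>J. toeplitz_form cinner (S (bp 1)) (nf_pow (x j)) (nf_pow (x l)) (h l) (h j))"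
    by (simp add: toeplitz_cinner)
  then show ?case
    using contracted_form.toeplitz_nonneg[OF cinner_contracted J, of "\<lambda>j. nf_pow (x j)" h] by simp
next
  case (Suc d)
  have "(\<Sum>j\<in>J. \<Sum>l\<in>J. kform (val (x j)) (val (x l)) (h l) (h j)) =
      (\<Sum>j\<in>J. \<Sum>l\<in>J. (\<Sum>i<m. kform (val (nf_comp i (x j))) (val (nf_comp i (x l)))
          (nf_comp_vec i (x l) (h l)) (nf_comp_vec i (x j) (h j))) +
        toeplitz_form defect (S (bp 1)) (nf_pow (x j)) (nf_pow (x l))
          (nf_pow_vec (x l) (h l)) (nf_pow_vec (x j) (h j)))"
    by (intro sum.cong HOL.refl kform_decomposition Suc.prems)
  also have "\<dots> = (\<Sum>i<m. \<Sum>j\<in>J. \<Sum>l\<in>J. kform (val (nf_comp i (x j))) (val (nf_comp i (x l)))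
          (nf_comp_vec i (x l) (h l)) (nf_comp_vec i (x j) (h j))) +
      (\<Sum>j\<in>J. \<Sum>l\<in>J. toeplitz_form defect (S (bp 1)) (nf_pow (x j)) (nf_pow (x l))
          (nf_pow_vec (x l) (h l)) (nf_pow_vec (x j) (h j)))"
    by (simp add: sum.distrib sum.swap[of _ "{..<m}"])
  also have "0 \<le> \<dots>"
  proof (rule add_nonneg_nonneg[OF sum_nonneg])
    show "0 \<le> (\<Sum>j\<in>J. \<Sum>l\<in>J. kform (val (nf_comp i (x j))) (val (nf_comp i (x l)))
          (nf_comp_vec i (x l) (h l)) (nf_comp_vec i (x j) (h j)))" for i
      using Suc.prems nf_comp_valid nf_comp_depth by (intro Suc.IH) auto
    show "0 \<le> (\<Sum>j\<in>J. \<Sum>l\<in>J. toeplitz_form defect (S (bp 1)) (nf_pow (x j)) (nf_pow (x l))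
          (nf_pow_vec (x l) (h l)) (nf_pow_vec (x j) (h j)))"
      by (rule contracted_form.toeplitz_nonneg[OF defect_contracted[OF dc] J])
  qed
  finally show ?case .
qed

lemma star_regular_if_defect:
  assumes defect_conditions
  shows "star_regular P T"
  unfolding star_regular_iff
proof (intro allI impI)
  fix k :: nat and p h assume "\<forall>i<k. p i \<in> carrier P"
  then have "\<forall>i. \<exists>x. i < k \<longrightarrow> valid x \<and> p i = val x"
    by (metis carrierE)
  then obtain x where x: "\<And>i. i < k \<Longrightarrow> valid (x i) \<and> p i = val (x i)"
    by metis
  \<comment> \<open>The sum of all depths is a common bound, also for an empty family.\<close>
  have "0 \<le> (\<Sum>i<k. \<Sum>j<k. kform (val (x i)) (val (x j)) (h j) (h i))"
    by (rule kform_nonneg[OF assms, where d = "\<Sum>i<k. nf_depth (x i)"])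
      (use x in \<open>auto intro: member_le_sum\<close>)
  then show "0 \<le> (\<Sum>i<k. \<Sum>j<k. kform (p i) (p j) (h j) (h i))"
    using x by simp
qed

section \<open>Necessity: test vectors for the kernel\<close>

lemma defect_nonneg:
  assumes "star_regular P T"
  shows "0 \<le> defect h h"
proof -
  define p where "p i = (case i of 0 \<Rightarrow> \<one>\<^bsub>P\<^esub> | Suc j \<Rightarrow> bpa j)" for i
  define v where "v i = (case i of 0 \<Rightarrow> h | Suc j \<Rightarrow> - S (bpa j) h)" for i
  have left: "kform (bpa i) \<one>\<^bsub>P\<^esub> h (- S (bpa i) h) = - zq (bpa i) h" for i
    using kform_commute[of "\<one>\<^bsub>P\<^esub>" "bpa i"]
    by (simp add: kform_one_left zq_def flip: cinner_commute)
  \<comment> \<open>Distinct b^i a have disjoint ideals, so this block is diagonal. The row and the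
    column of the identity each contribute the negative of its sum, leaving one negative copy in
    total.\<close>
  have diag: "(\<Sum>i<m. \<Sum>j<m. kform (bpa i) (bpa j) (- S (bpa j) h) (- S (bpa i) h)) =
      (\<Sum>i<m. zq (bpa i) h)"
  proof (rule sum.cong[OF HOL.refl])
    fix i assume i: "i \<in> {..<m}"
    have "kform (bpa i) (bpa j) (- S (bpa j) h) (- S (bpa i) h) = (if j = i then zq (bpa i) h else 0)"
      if "j < m" for j
      using that i kform_disjoint[OF _ _ bpa_disjoint[of i j]] by (simp add: kform_self zq_def)
    then show "(\<Sum>j<m. kform (bpa i) (bpa j) (- S (bpa j) h) (- S (bpa i) h)) = zq (bpa i) h"
      using i by simp
  qed
  have "p i \<in> carrier P" for i
    by (simp add: p_def split: nat.split)
  then have "0 \<le> (\<Sum>i<Suc m. \<Sum>j<Suc m. kform (p i) (p j) (v j) (v i))"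
    using assms unfolding star_regular_iff by blast
  also have "\<dots> = kform \<one>\<^bsub>P\<^esub> \<one>\<^bsub>P\<^esub> h h + (\<Sum>j<m. kform \<one>\<^bsub>P\<^esub> (bpa j) (- S (bpa j) h) h)
      + ((\<Sum>i<m. kform (bpa i) \<one>\<^bsub>P\<^esub> h (- S (bpa i) h))
      + (\<Sum>i<m. \<Sum>j<m. kform (bpa i) (bpa j) (- S (bpa j) h) (- S (bpa i) h)))"
    by (simp add: sum.lessThan_Suc_shift p_def v_def sum.distrib del: sum.lessThan_Suc)
  also have "\<dots> = defect h h"
    unfolding diag by (simp add: kform_self kform_one_left left defect_self sum_negf flip: zq_def)
  finally show ?thesis .
qed

lemma defect_contract:
  assumes "star_regular P T"
  shows "defect (S (bp 1) h) (S (bp 1) h) \<le> defect h h"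
proof -
  \<comment> \<open>The least common multiples of the subsets of {b, a}; the vectors carry the
    inclusion-exclusion signs.\<close>
  define p where "p i = [\<one>\<^bsub>P\<^esub>, bp 1, bpa 0, bpa m] ! i" for i
  define w where "w = S (bpa m) h"
  define v where "v i = [h, - S (bp 1) h, - S (bpa 0) h, w] ! i" for i
  have b: "bpa m = bp 1 \<otimes>\<^bsub>P\<^esub> bpa (m - 1)"
    using m_pos by (simp add: bp_bpa)
  have a: "bpa m = bpa 0 \<otimes>\<^bsub>P\<^esub> bp n"
    by (simp add: bpa_0_bp_n)
  have Sb: "S (bpa (m - 1)) (S (bp 1) h) = w"
    unfolding w_def b by (simp add: S_mult)
  have Sa: "S (bp n) (S (bpa 0) h) = w"
    unfolding w_def a by (simp add: S_mult)
  let ?K = "\<lambda>i j. kform (p i) (p j) (v j) (v i)"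
  have p: "p i \<in> carrier P" if "i < 4" for i
    using that by (auto simp: p_def less_Suc_eq numeral_eq_Suc)
  \<comment> \<open>The only pair without divisibility; its cofactors are b^{m-1} a and b^n, and
    both lead to the vector \<open>w\<close>.\<close>
  have "is_lcm (bp 1) (bpa 0) (bp 1 \<otimes>\<^bsub>P\<^esub> bpa (m - 1))"
    using is_lcm_b_a unfolding b .
  moreover have "bp 1 \<otimes>\<^bsub>P\<^esub> bpa (m - 1) = bpa 0 \<otimes>\<^bsub>P\<^esub> bp n"
    using a b by simp
  ultimately have ba: "kform (bp 1) (bpa 0) x y = cinner (S (bp n) x) (S (bpa (m - 1)) y)" for x y
    by (intro kform_lcm) simp_all
  have upper:
    "?K 0 0 = cinner h h" "?K 0 1 = - zq (bp 1) h" "?K 0 2 = - zq (bpa 0) h" "?K 0 3 = zq (bpa m) h"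
    "?K 1 1 = zq (bp 1) h" "?K 1 2 = zq (bpa m) h" "?K 1 3 = - zq (bpa m) h"
    "?K 2 2 = zq (bpa 0) h" "?K 2 3 = - zq (bpa m) h" "?K 3 3 = zq (bpa m) h"
    using kform_dvd[of "bp 1" "bpa (m - 1)"] kform_dvd[of "bpa 0" "bp n"]
    by (simp_all add: p_def v_def zq_def kform_one_left kform_self ba Sa Sb
        flip: a b w_def del: One_nat_def)
  have cnj_zq: "cnj (zq q h) = zq q h" for q
    by (simp add: zq_def flip: cinner_commute)
  have herm: "?K j i = cnj (?K i j)" if "i < 4" "j < 4" for i j
    using that p by (intro kform_commute) auto
  have lower: "?K 1 0 = - zq (bp 1) h" "?K 2 0 = - zq (bpa 0) h" "?K 3 0 = zq (bpa m) h"
    "?K 2 1 = zq (bpa m) h" "?K 3 1 = - zq (bpa m) h" "?K 3 2 = - zq (bpa m) h"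
    by (simp_all add: herm[of 0 1] herm[of 0 2] herm[of 0 3] herm[of 1 2] herm[of 1 3] herm[of 2 3]
        upper cnj_zq del: One_nat_def)
  have "0 \<le> (\<Sum>i<4. \<Sum>j<4. ?K i j)"
    using assms p by (simp add: star_regular_iff)
  \<comment> \<open>The rows of b, a and b^m a sum to 0, so the total is the row of the
    identity.\<close>
  also have "\<dots> = cinner h h - zq (bp 1) h - (zq (bpa 0) h - zq (bpa m) h)"
    using upper lower by (simp add: eval_nat_numeral)
  finally show ?thesis
    unfolding defect_diff[symmetric] by simp
qed

end

theorem theorem5p13:
  fixes n m :: nat
    and T :: "bs_gen list set \<Rightarrow> ('h::chilbert_space \<Rightarrow>\<^sub>L 'h)"
  assumes "n \<ge> 1" and "m \<ge> 1"
    and "contractive_rep (BS n m) T"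
  shows "star_regular (BS n m) T \<longleftrightarrow>
    (\<forall>F. finite F \<and> F \<subseteq> P00 n m \<longrightarrow> positive_op (Z (BS n m) T F))"
proof -
  interpret bs_rep n m T
    using assms by unfold_locales simp_all
  have "star_regular (BS n m) T \<longleftrightarrow> defect_conditions"
  proof
    assume "star_regular (BS n m) T"
    then show defect_conditions
      unfolding defect_conditions_def by (intro allI conjI defect_nonneg defect_contract)
  qed (rule star_regular_if_defect)
  then show ?thesis
    unfolding positive_Z_iff .
qed

end
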